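(* Let $\gamma:I\to\mathbb{G}$ be a unit speed Frenet curve with curvature $\kappa$ and torsion $\tau$, and let $\beta$ be its natural mate, with Frenet-Serret apparatus $\{\overline T,\overline N,\overline B,\overline\kappa,\overline\tau\}$. Then $\gamma$ is a rectifying curve if and only if there is a nonzero constant $a$ such that $$a\,\kappa^2=(\overline\tau-\overline{\tau_{\mathbb G}})\,\overline\kappa^{\,2},$$ where $\overline{\tau_{\mathbb G}}=\frac12\langle[\overline T,\overline N],\overline B\rangle$.
   Context: Let $\mathbb{G}$ be a three-dimensional Lie group with a bi-invariant Riemannian metric $\langle\cdot,\cdot\rangle$, with (oriented) Lie algebra $\mathfrak g$ and Levi-Civita connection $\nabla$; $I\subset\mathbb R$ is an interval and curves are smooth. Vector fields along a curve in $\mathbb G$ are identified with $\mathfrak g$-valued maps by left translation: fixing an orthonormal basis $X_1,X_2,X_3$ of left-invariant fields, write $U=\sum u_iX_i$, and set $U'=\sum u_i'X_i$, $[U,V]=\sum u_iv_j[X_i,X_j]$; then $\nabla_TU=U'+\frac12[T,U]$ with $T=\gamma'$. Vector fields along different curves with the same parameter interval are compared as $\mathfrak g$-valued maps. A unit speed curve $\gamma$ has Frenet-Serret apparatus $\{T,N,B,\kappa,\tau\}$ if $\kappa=\|\nabla_TT\|>0$, $(T,N,B)$ is a positively oriented orthonormal frame, and $\nabla_TT=\kappa N$, $\nabla_TN=-\kappa T+\tau B$, $\nabla_TB=-\tau N$. It is a Frenet curve if moreover $\tau\neq0$. The Lie group torsion is $\tau_{\mathbb G}=\frac12\langle[T,N],B\rangle$;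 the harmonic curvature is $H=(\tau-\tau_{\mathbb G})/\kappa$. A unit speed curve $\beta:I\to\mathbb G$ with Frenet-Serret apparatus $\{\overline T,\overline N,\overline B,\overline\kappa,\overline\tau\}$ is the natural mate of $\gamma$ if $\overline T=N$. A unit speed curve with arc-length parameter $s$ is a rectifying curve iff $H(s)=as+b$ for constants $a\neq0$ and $b$ (the characterization used, taken as the definition). *)

theory Defs
  imports "HOL-Analysis.Analysis"
begin

section \<open>Smooth maps between Euclidean spaces\<close>

primrec Ck_on ::
  "nat \<Rightarrow> ('a::euclidean_space \<Rightarrow> 'b::euclidean_space) \<Rightarrow> 'a set \<Rightarrow> bool" where
  "Ck_on 0 f S \<longleftrightarrow> continuous_on S f"
| "Ck_on (Suc k) f S \<longleftrightarrow>
     (\<forall>x\<in>S. f differentiable (at x)) \<and>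
     (\<forall>v. Ck_on k (\<lambda>x. frechet_derivative f (at x) v) S)"

text \<open>On a set that need not be open (such as an interval containing an end point), smoothness
  means local extendability to a smooth map on an open set.\<close>

definition smooth_on ::
  "'a::euclidean_space set \<Rightarrow> ('a \<Rightarrow> 'b::euclidean_space) \<Rightarrow> bool" where
  "smooth_on S f \<longleftrightarrow>
     (\<forall>x\<in>S. \<exists>W g. open W \<and> x \<in> W \<and> (\<forall>k. Ck_on k g W) \<and> (\<forall>y\<in>S \<inter> W. g y = f y))"

section \<open>Three-dimensional Lie groups\<close>

text \<open>The group is a whole type, written multiplicatively, with \<open>ginv\<close> as inversion; its manifold
  structure is given by a smooth atlas, not required to be maximal.\<close>

class lie_group_3 = topological_semigroup_mult + monoid_mult + t2_space + second_countable_topology +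
  fixes ginv :: "'a \<Rightarrow> 'a"
    and atlas :: "('a set \<times> ('a \<Rightarrow> real^3)) set"
  assumes ginv_left: "ginv a * a = 1"
    and chart_homeomorphism:
      "(U, \<phi>) \<in> atlas \<Longrightarrow>
         open U \<and> inj_on \<phi> U \<and> (\<forall>V\<subseteq>U. open (\<phi> ` V) \<longleftrightarrow> open V)"
    and atlas_covers: "\<exists>U \<phi>. (U, \<phi>) \<in> atlas \<and> p \<in> U"
    and transition_smooth:
      "(U, \<phi>) \<in> atlas \<Longrightarrow> (V, \<psi>) \<in> atlas \<Longrightarrow>
         smooth_on (\<phi> ` (U \<inter> V)) (\<lambda>x. \<psi> (inv_into U \<phi> x))"
    and mult_smooth:
      "(U, \<phi>) \<in> atlas \<Longrightarrow> (V, \<psi>) \<in> atlas \<Longrightarrow> (W, \<theta>) \<in> atlas \<Longrightarrow>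
         smooth_on {(x, y). x \<in> \<phi> ` U \<and> y \<in> \<psi> ` V \<and> inv_into U \<phi> x * inv_into V \<psi> y \<in> W}
           (\<lambda>(x, y). \<theta> (inv_into U \<phi> x * inv_into V \<psi> y))"
    and ginv_continuous: "open V \<Longrightarrow> open (ginv -` V)"
    and ginv_smooth:
      "(U, \<phi>) \<in> atlas \<Longrightarrow> (V, \<psi>) \<in> atlas \<Longrightarrow>
         smooth_on {x \<in> \<phi> ` U. ginv (inv_into U \<phi> x) \<in> V} (\<lambda>x. \<psi> (ginv (inv_into U \<phi> x)))"

definition smooth_fun :: "('g::lie_group_3 \<Rightarrow> real) \<Rightarrow> bool" where
  "smooth_fun f \<longleftrightarrow> (\<forall>(U, \<phi>)\<in>atlas. smooth_on (\<phi> ` U) (\<lambda>x. f (inv_into U \<phi> x)))"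

definition smooth_curve :: "real set \<Rightarrow> (real \<Rightarrow> 'g::lie_group_3) \<Rightarrow> bool" where
  "smooth_curve I c \<longleftrightarrow>
     continuous_on I c \<and> (\<forall>(U, \<phi>)\<in>atlas. smooth_on {t \<in> I. c t \<in> U} (\<lambda>t. \<phi> (c t)))"

section \<open>Tangent vectors and vector fields\<close>

text \<open>A tangent vector is the velocity of a smooth curve, seen as a derivation on smooth functions.
  To make it determined by its action on smooth functions, it is set to 0 on all other functions.\<close>

type_synonym 'g tvec = "('g \<Rightarrow> real) \<Rightarrow> real"
type_synonym 'g vfield = "'g \<Rightarrow> 'g tvec"
type_synonym 'g metric = "'g \<Rightarrow> 'g tvec \<Rightarrow> 'g tvec \<Rightarrow> real"
type_synonym 'g connection = "'g vfield \<Rightarrow> 'g vfield \<Rightarrow> 'g vfield"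

definition velocity :: "real set \<Rightarrow> (real \<Rightarrow> 'g::lie_group_3) \<Rightarrow> real \<Rightarrow> 'g tvec" where
  "velocity I c t =
     (\<lambda>f. if smooth_fun f then vector_derivative (\<lambda>s. f (c s)) (at t within I) else 0)"

definition tangent_space :: "'g::lie_group_3 \<Rightarrow> 'g tvec set" where
  "tangent_space p =
     {velocity {-\<epsilon><..<\<epsilon>} c 0 | c \<epsilon>. 0 < \<epsilon> \<and> smooth_curve {-\<epsilon><..<\<epsilon>} c \<and> c 0 = p}"

text \<open>The differential of \<open>F\<close>; it is only applied to the diffeomorphisms given by translations.\<close>

definition pushforward :: "('g \<Rightarrow> 'g) \<Rightarrow> 'g tvec \<Rightarrow> 'g tvec" where
  "pushforward F v = (\<lambda>f. v (\<lambda>x. f (F x)))"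

definition vector_field :: "'g::lie_group_3 vfield \<Rightarrow> bool" where
  "vector_field X \<longleftrightarrow>
     (\<forall>p. X p \<in> tangent_space p) \<and> (\<forall>f. smooth_fun f \<longrightarrow> smooth_fun (\<lambda>p. X p f))"

definition vf_add :: "'g vfield \<Rightarrow> 'g vfield \<Rightarrow> 'g vfield" where
  "vf_add X Y = (\<lambda>p f. X p f + Y p f)"

definition vf_diff :: "'g vfield \<Rightarrow> 'g vfield \<Rightarrow> 'g vfield" where
  "vf_diff X Y = (\<lambda>p f. X p f - Y p f)"

definition vf_mult :: "('g \<Rightarrow> real) \<Rightarrow> 'g vfield \<Rightarrow> 'g vfield" where
  "vf_mult h X = (\<lambda>p f. h p * X p f)"

definition vf_scale :: "real \<Rightarrow> 'g vfield \<Rightarrow> 'g vfield" where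
  "vf_scale c X = vf_mult (\<lambda>_. c) X"

definition lie_bracket :: "'g vfield \<Rightarrow> 'g vfield \<Rightarrow> 'g vfield" where
  "lie_bracket X Y = (\<lambda>p f. X p (\<lambda>q. Y q f) - Y p (\<lambda>q. X q f))"

definition lie_algebra :: "'g::lie_group_3 vfield set" where
  "lie_algebra =
     {X. vector_field X \<and> (\<forall>a p. X (a * p) = pushforward (\<lambda>x. a * x) (X p))}"

section \<open>Bi-invariant metric and Levi-Civita connection\<close>

definition riemannian_metric :: "'g::lie_group_3 metric \<Rightarrow> bool" where
  "riemannian_metric m \<longleftrightarrow>
     (\<forall>p. \<forall>u\<in>tangent_space p. \<forall>v\<in>tangent_space p.
        m p u v = m p v u \<and>
        (\<forall>c. m p (\<lambda>f. c * u f) v = c * m p u v) \<and>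
        (\<forall>w\<in>tangent_space p. m p (\<lambda>f. u f + w f) v = m p u v + m p w v) \<and>
        (u \<noteq> (\<lambda>f. 0) \<longrightarrow> 0 < m p u u)) \<and>
     (\<forall>X Y. vector_field X \<longrightarrow> vector_field Y \<longrightarrow> smooth_fun (\<lambda>p. m p (X p) (Y p)))"

definition bi_invariant :: "'g::lie_group_3 metric \<Rightarrow> bool" where
  "bi_invariant m \<longleftrightarrow>
     (\<forall>a p. \<forall>u\<in>tangent_space p. \<forall>v\<in>tangent_space p.
        m (a * p) (pushforward (\<lambda>x. a * x) u) (pushforward (\<lambda>x. a * x) v) = m p u v \<and>
        m (p * a) (pushforward (\<lambda>x. x * a) u) (pushforward (\<lambda>x. x * a) v) = m p u v)"

definition affine_connection :: "'g::lie_group_3 connection \<Rightarrow> bool" where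
  "affine_connection nabla \<longleftrightarrow>
     (\<forall>X Y. vector_field X \<longrightarrow> vector_field Y \<longrightarrow>
        vector_field (nabla X Y) \<and>
        (\<forall>Z. vector_field Z \<longrightarrow>
           nabla (vf_add X Z) Y = vf_add (nabla X Y) (nabla Z Y) \<and>
           nabla X (vf_add Y Z) = vf_add (nabla X Y) (nabla X Z)) \<and>
        (\<forall>h. smooth_fun h \<longrightarrow>
           nabla (vf_mult h X) Y = vf_mult h (nabla X Y) \<and>
           nabla X (vf_mult h Y) = vf_add (vf_mult (\<lambda>p. X p h) Y) (vf_mult h (nabla X Y))))"

definition levi_civita :: "'g::lie_group_3 metric \<Rightarrow> 'g connection \<Rightarrow> bool" where
  "levi_civita m nabla \<longleftrightarrow>
     affine_connection nabla \<and>
     (\<forall>X Y. vector_field X \<longrightarrow> vector_field Y \<longrightarrow>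
        vf_diff (nabla X Y) (nabla Y X) = lie_bracket X Y) \<and>
     (\<forall>X Y Z p. vector_field X \<longrightarrow> vector_field Y \<longrightarrow> vector_field Z \<longrightarrow>
        X p (\<lambda>q. m q (Y q) (Z q)) = m p (nabla X Y p) (Z p) + m p (Y p) (nabla X Z p))"

definition lie_inner :: "'g::lie_group_3 metric \<Rightarrow> 'g vfield \<Rightarrow> 'g vfield \<Rightarrow> real" where
  "lie_inner m X Y = m 1 (X 1) (Y 1)"

definition lie_norm :: "'g::lie_group_3 metric \<Rightarrow> 'g vfield \<Rightarrow> real" where
  "lie_norm m X = sqrt (lie_inner m X X)"

definition linear_comb :: "(3 \<Rightarrow> 'g vfield) \<Rightarrow> real^3 \<Rightarrow> 'g vfield" where
  "linear_comb X u = (\<lambda>p f. \<Sum>i\<in>UNIV. u $ i * X i p f)"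

definition orthonormal_basis :: "'g::lie_group_3 metric \<Rightarrow> (3 \<Rightarrow> 'g vfield) \<Rightarrow> bool" where
  "orthonormal_basis m X \<longleftrightarrow>
     (\<forall>i. X i \<in> lie_algebra) \<and>
     (\<forall>i j. lie_inner m (X i) (X j) = (if i = j then 1 else 0)) \<and>
     (\<forall>Y\<in>lie_algebra. \<exists>u. Y = linear_comb X u)"

text \<open>Coordinates of a left-invariant field with respect to an orthonormal basis.\<close>

definition coords :: "'g::lie_group_3 metric \<Rightarrow> (3 \<Rightarrow> 'g vfield) \<Rightarrow> 'g vfield \<Rightarrow> real^3" where
  "coords m X Y = (\<chi> i. lie_inner m Y (X i))"

text \<open>The Lie algebra is oriented by declaring the basis \<open>X\<close> to be positive; every orientation
  arises in this way.\<close>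

definition positive_frame ::
  "'g::lie_group_3 metric \<Rightarrow> (3 \<Rightarrow> 'g vfield) \<Rightarrow> 'g vfield \<Rightarrow> 'g vfield \<Rightarrow> 'g vfield \<Rightarrow> bool" where
  "positive_frame m X U V W \<longleftrightarrow>
     lie_inner m U U = 1 \<and> lie_inner m V V = 1 \<and> lie_inner m W W = 1 \<and>
     lie_inner m U V = 0 \<and> lie_inner m U W = 0 \<and> lie_inner m V W = 0 \<and>
     det (vector [coords m X U, coords m X V, coords m X W] :: real^3^3) > 0"

section \<open>Curves\<close>

text \<open>A vector field along a curve \<open>\<gamma>\<close> is represented by a map \<open>U\<close> from the parameter interval to
  the Lie algebra, the actual vector at parameter \<open>t\<close> being \<open>U t (\<gamma> t)\<close>.\<close>

definition smooth_lie_map ::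
  "'g::lie_group_3 metric \<Rightarrow> (3 \<Rightarrow> 'g vfield) \<Rightarrow> real set \<Rightarrow> (real \<Rightarrow> 'g vfield) \<Rightarrow> bool" where
  "smooth_lie_map m X I U \<longleftrightarrow>
     (\<forall>t\<in>I. U t \<in> lie_algebra) \<and> smooth_on I (\<lambda>t. coords m X (U t))"

definition lie_deriv_map ::
  "'g::lie_group_3 metric \<Rightarrow> (3 \<Rightarrow> 'g vfield) \<Rightarrow> real set \<Rightarrow> (real \<Rightarrow> 'g vfield) \<Rightarrow> real \<Rightarrow> 'g vfield" where
  "lie_deriv_map m X I U t =
     linear_comb X (vector_derivative (\<lambda>s. coords m X (U s)) (at t within I))"

text \<open>The covariant derivative of \<open>U = \<Sum>\<^sub>i u\<^sub>i X\<^sub>i\<close> along a curve with velocity \<open>T\<close> is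
  \<open>\<Sum>\<^sub>i u\<^sub>i' X\<^sub>i + \<Sum>\<^sub>i u\<^sub>i \<nabla>\<^sub>T X\<^sub>i\<close>. For fixed \<open>t\<close> the second sum is the
  Levi-Civita derivative of the left-invariant field \<open>U t\<close> in the direction of the left-invariant
  field \<open>T t\<close>; for a bi-invariant metric it equals half the bracket of \<open>T t\<close> and \<open>U t\<close>.\<close>

definition cov_deriv ::
  "'g::lie_group_3 metric \<Rightarrow> 'g connection \<Rightarrow> (3 \<Rightarrow> 'g vfield) \<Rightarrow> real set \<Rightarrow>
   (real \<Rightarrow> 'g vfield) \<Rightarrow> (real \<Rightarrow> 'g vfield) \<Rightarrow> real \<Rightarrow> 'g vfield" where
  "cov_deriv m nabla X I T U t = vf_add (lie_deriv_map m X I U t) (nabla (T t) (U t))"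

definition unit_speed :: "'g::lie_group_3 metric \<Rightarrow> real set \<Rightarrow> (real \<Rightarrow> 'g) \<Rightarrow> bool" where
  "unit_speed m I \<gamma> \<longleftrightarrow>
     smooth_curve I \<gamma> \<and> (\<forall>t\<in>I. m (\<gamma> t) (velocity I \<gamma> t) (velocity I \<gamma> t) = 1)"

definition frenet_apparatus ::
  "'g::lie_group_3 metric \<Rightarrow> 'g connection \<Rightarrow> (3 \<Rightarrow> 'g vfield) \<Rightarrow> real set \<Rightarrow> (real \<Rightarrow> 'g) \<Rightarrow>
   (real \<Rightarrow> 'g vfield) \<Rightarrow> (real \<Rightarrow> 'g vfield) \<Rightarrow> (real \<Rightarrow> 'g vfield) \<Rightarrow>
   (real \<Rightarrow> real) \<Rightarrow> (real \<Rightarrow> real) \<Rightarrow> bool" where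
  "frenet_apparatus m nabla X I \<gamma> T N B \<kappa> \<tau> \<longleftrightarrow>
     unit_speed m I \<gamma> \<and>
     smooth_lie_map m X I T \<and> smooth_lie_map m X I N \<and> smooth_lie_map m X I B \<and>
     (\<forall>t\<in>I.
        T t (\<gamma> t) = velocity I \<gamma> t \<and>
        \<kappa> t = lie_norm m (cov_deriv m nabla X I T T t) \<and> \<kappa> t > 0 \<and>
        positive_frame m X (T t) (N t) (B t) \<and>
        cov_deriv m nabla X I T T t = vf_scale (\<kappa> t) (N t) \<and>
        cov_deriv m nabla X I T N t = vf_add (vf_scale (- \<kappa> t) (T t)) (vf_scale (\<tau> t) (B t)) \<and>
        cov_deriv m nabla X I T B t = vf_scale (- \<tau> t) (N t))"

definition frenet_curve ::
  "'g::lie_group_3 metric \<Rightarrow> 'g connection \<Rightarrow> (3 \<Rightarrow> 'g vfield) \<Rightarrow> real set \<Rightarrow> (real \<Rightarrow> 'g) \<Rightarrow>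
   (real \<Rightarrow> 'g vfield) \<Rightarrow> (real \<Rightarrow> 'g vfield) \<Rightarrow> (real \<Rightarrow> 'g vfield) \<Rightarrow>
   (real \<Rightarrow> real) \<Rightarrow> (real \<Rightarrow> real) \<Rightarrow> bool" where
  "frenet_curve m nabla X I \<gamma> T N B \<kappa> \<tau> \<longleftrightarrow>
     frenet_apparatus m nabla X I \<gamma> T N B \<kappa> \<tau> \<and> (\<forall>t\<in>I. \<tau> t \<noteq> 0)"

definition lie_torsion ::
  "'g::lie_group_3 metric \<Rightarrow> (real \<Rightarrow> 'g vfield) \<Rightarrow> (real \<Rightarrow> 'g vfield) \<Rightarrow> (real \<Rightarrow> 'g vfield) \<Rightarrow>
   real \<Rightarrow> real" where
  "lie_torsion m T N B t = 1/2 * lie_inner m (lie_bracket (T t) (N t)) (B t)"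

definition harmonic_curvature ::
  "'g::lie_group_3 metric \<Rightarrow> (real \<Rightarrow> 'g vfield) \<Rightarrow> (real \<Rightarrow> 'g vfield) \<Rightarrow> (real \<Rightarrow> 'g vfield) \<Rightarrow>
   (real \<Rightarrow> real) \<Rightarrow> (real \<Rightarrow> real) \<Rightarrow> real \<Rightarrow> real" where
  "harmonic_curvature m T N B \<kappa> \<tau> t = (\<tau> t - lie_torsion m T N B t) / \<kappa> t"

text \<open>\<open>\<beta>\<close> has the Frenet-Serret apparatus \<open>T' N' B' \<kappa>' \<tau>'\<close> and is the natural mate of a curve
  with principal normal \<open>N\<close>.\<close>

definition natural_mate ::
  "'g::lie_group_3 metric \<Rightarrow> 'g connection \<Rightarrow> (3 \<Rightarrow> 'g vfield) \<Rightarrow> real set \<Rightarrow>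
   (real \<Rightarrow> 'g vfield) \<Rightarrow> (real \<Rightarrow> 'g) \<Rightarrow>
   (real \<Rightarrow> 'g vfield) \<Rightarrow> (real \<Rightarrow> 'g vfield) \<Rightarrow> (real \<Rightarrow> 'g vfield) \<Rightarrow>
   (real \<Rightarrow> real) \<Rightarrow> (real \<Rightarrow> real) \<Rightarrow> bool" where
  "natural_mate m nabla X I N \<beta> T' N' B' \<kappa>' \<tau>' \<longleftrightarrow>
     frenet_apparatus m nabla X I \<beta> T' N' B' \<kappa>' \<tau>' \<and> (\<forall>t\<in>I. T' t = N t)"

definition rectifying_curve ::
  "'g::lie_group_3 metric \<Rightarrow> 'g connection \<Rightarrow> (3 \<Rightarrow> 'g vfield) \<Rightarrow> real set \<Rightarrow> (real \<Rightarrow> 'g) \<Rightarrow> bool" where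
  "rectifying_curve m nabla X I \<gamma> \<longleftrightarrow>
     (\<exists>T N B \<kappa> \<tau>. frenet_apparatus m nabla X I \<gamma> T N B \<kappa> \<tau> \<and>
        (\<exists>a b. a \<noteq> 0 \<and> (\<forall>s\<in>I. harmonic_curvature m T N B \<kappa> \<tau> s = a * s + b)))"

end

theory Submission
  imports Defs
begin

text \<open>The harmonic curvature \<open>H\<close> of \<open>\<gamma>\<close> satisfies
  \<open>(dH/ds) \<kappa>\<^sup>2 = (\<tau>' - \<tau>'\<^sub>G) \<kappa>'\<^sup>2\<close>, where primes mark the quantities of the natural mate and
  \<open>\<tau>'\<^sub>G\<close> is its Lie group torsion. Hence the equation of the theorem says
  precisely that \<open>H\<close> has constant nonzero derivative \<open>a\<close> on the interval, that is, \<open>H s = a * s + b\<close>.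

  To obtain the identity, left translation turns everything into curves in \<open>\<real>\<^sup>3\<close>. For a bi-invariant
  metric the form \<open>\<langle>\<nabla>\<^sub>A B, C\<rangle>\<close> on left-invariant fields is alternating, so along a Frenet curve the
  only effect of the connection is to replace \<open>\<tau>\<close> by \<open>\<mu> = \<tau> - \<tau>\<^sub>G\<close>: the coordinates of the frame
  satisfy the Euclidean Frenet equations \<open>dt/ds = \<kappa> n\<close>, \<open>dn/ds = - \<kappa> t + \<mu> b\<close>, \<open>db/ds = - \<mu> n\<close>
  (\<open>frenet_apparatus_equations\<close>). The tangent of the mate is \<open>n\<close>, so its curvature times its normal is
  \<open>- \<kappa> t + \<mu> b\<close>; thus \<open>H = \<mu> / \<kappa>\<close> is minus the ratio of the components of that normal along \<open>b\<close> and
  \<open>t\<close>, and the Frenet equations of both curves give its derivative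
  (\<open>natural_mate_ratio_derivative\<close>).

  The definition of a rectifying curve admits any apparatus of \<open>\<gamma>\<close>, so it also matters that the
  tangent determines \<open>\<kappa>\<close> and \<open>\<mu>\<close>, and with them \<open>H\<close> (\<open>frenet_unique\<close>).

  The alternating property (\<open>connection_form_skew\<close>) is where bi-invariance enters. Antisymmetry in
  \<open>B\<close> and \<open>C\<close> holds because \<open>\<langle>B, C\<rangle>\<close> is constant for left-invariant fields. For antisymmetry in
  \<open>A\<close> and \<open>C\<close>, extend the values of \<open>A\<close> and \<open>C\<close> at \<open>1\<close> to right-invariant fields. The metric is
  also constant on those, and they commute with the left-invariant \<open>B\<close>, because the two invariant
  fields differentiate \<open>f (x * y)\<close> in different variables. So \<open>\<nabla>\<^sub>B\<close> of a right-invariant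
  field may be exchanged for the derivative of \<open>B\<close> along it, which depends only on its value at \<open>1\<close>.\<close>

section \<open>Calculus of \<open>C\<^sup>k\<close> maps\<close>

lemma Ck_on_cong:
  assumes "open S" and "\<And>x. x \<in> S \<Longrightarrow> f x = g x"
  shows "Ck_on k f S \<longleftrightarrow> Ck_on k g S"
  using assms
proof (induction k arbitrary: f g)
  case 0
  then show ?case by (simp cong: continuous_on_cong)
next
  case (Suc k)
  have der: "(f has_derivative D) (at x) \<longleftrightarrow> (g has_derivative D) (at x)" if "x \<in> S" for x D
    using has_derivative_transform_within_open[OF _ Suc.prems(1) that]
      Suc.prems(2) by metis
  have "f differentiable (at x) \<longleftrightarrow> g differentiable (at x)" if "x \<in> S" for x
    using der[OF that] by (simp add: differentiable_def)
  moreover have "Ck_on k (\<lambda>x. frechet_derivative f (at x) v) S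
      \<longleftrightarrow> Ck_on k (\<lambda>x. frechet_derivative g (at x) v) S" for v
    using der by (intro Suc.IH) (auto simp: frechet_derivative_def Suc.prems(1))
  ultimately show ?case by auto
qed

lemma Ck_on_subset: "Ck_on k f S \<Longrightarrow> R \<subseteq> S \<Longrightarrow> Ck_on k f R"
  by (induction k arbitrary: f) (auto intro: continuous_on_subset)

lemma Ck_on_local:
  assumes "\<And>x. x \<in> S \<Longrightarrow> \<exists>W. open W \<and> x \<in> W \<and> Ck_on k f W"
  shows "Ck_on k f S"
  using assms
proof (induction k arbitrary: f)
  case 0
  have "continuous (at x) f" if "x \<in> S" for x
    using 0[OF that] continuous_on_eq_continuous_at by auto
  then show ?case by (simp add: continuous_at_imp_continuous_on)
next
  case (Suc k)
  have "f differentiable (at x)" if "x \<in> S" for x using Suc.prems[OF that] by auto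
  moreover have "Ck_on k (\<lambda>x. frechet_derivative f (at x) v) S" for v
  proof (rule Suc.IH)
    fix x assume "x \<in> S"
    from Suc.prems[OF this] show "\<exists>W. open W \<and> x \<in> W \<and> Ck_on k (\<lambda>x. frechet_derivative f (at x) v) W"
      by auto
  qed
  ultimately show ?case by simp
qed

text \<open>Reduces \<open>C\<^sup>k\<^sup>+\<^sup>1\<close> to any explicit formula for the derivative, so that the inductions below can
  use the usual differentiation rules instead of \<^const>\<open>frechet_derivative\<close>.\<close>

lemma Ck_on_SucI:
  assumes "open S" and "\<And>x. x \<in> S \<Longrightarrow> (f has_derivative D x) (at x)"
    and "\<And>v. Ck_on k (\<lambda>x. D x v) S"
  shows "Ck_on (Suc k) f S"
proof -
  have "Ck_on k (\<lambda>x. frechet_derivative f (at x) v) S" for v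
    using assms(3)[of v] Ck_on_cong[OF assms(1), of "\<lambda>x. frechet_derivative f (at x) v" "\<lambda>x. D x v"]
      frechet_derivative_at[OF assms(2)] by simp
  then show ?thesis using assms(2) by (auto simp: differentiable_def)
qed

lemma Ck_on_Suc_has_derivative:
  assumes "Ck_on (Suc k) f S" and "x \<in> S"
  shows "(f has_derivative frechet_derivative f (at x)) (at x)"
  using assms frechet_derivative_works by auto

lemma Ck_on_Suc_imp: "Ck_on (Suc k) f S \<Longrightarrow> Ck_on k f S"
proof (induction k arbitrary: f)
  case 0
  then show ?case
    by (auto intro!: differentiable_imp_continuous_on simp: differentiable_on_def differentiable_at_withinI)
next
  case (Suc k)
  then show ?case by (metis Ck_on.simps(2))
qed

lemma Ck_on_const: "Ck_on k (\<lambda>x. c) S"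
  by (induction k arbitrary: c) auto

lemma Ck_on_affine:
  assumes "bounded_linear L" and "open S"
  shows "Ck_on k (\<lambda>x. c + L x) S"
proof (cases k)
  case 0
  then show ?thesis using linear_continuous_on[OF assms(1)]
    by (auto intro!: continuous_intros)
next
  case (Suc j)
  have "((\<lambda>x. c + L x) has_derivative L) (at x)" for x
    using assms(1) by (auto intro!: derivative_eq_intros bounded_linear_imp_has_derivative)
  then show ?thesis unfolding Suc
    by (intro Ck_on_SucI[where D="\<lambda>_. L"] assms(2)) (auto intro: Ck_on_const)
qed

lemma Ck_on_add:
  assumes "open S" "Ck_on k f S" "Ck_on k g S"
  shows "Ck_on k (\<lambda>x. f x + g x) S"
  using assms
proof (induction k arbitrary: f g)
  case 0
  then show ?case by (auto intro: continuous_intros)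
next
  case (Suc k)
  show ?case
    by (rule Ck_on_SucI[OF Suc.prems(1) has_derivative_add[OF
          Ck_on_Suc_has_derivative[OF Suc.prems(2)] Ck_on_Suc_has_derivative[OF Suc.prems(3)]]])
       (use Suc in auto)
qed

lemma Ck_on_sum:
  assumes "open S" "\<And>i. i \<in> A \<Longrightarrow> Ck_on k (f i) S"
  shows "Ck_on k (\<lambda>x. \<Sum>i\<in>A. f i x) S"
  using assms(2) by (induction A rule: infinite_finite_induct)
    (auto intro: Ck_on_const Ck_on_add[OF assms(1)])

lemma Ck_on_scaleR:
  fixes f :: "'a::euclidean_space \<Rightarrow> real" and g :: "'a \<Rightarrow> 'b::euclidean_space"
  assumes "open S" "Ck_on k f S" "Ck_on k g S"
  shows "Ck_on k (\<lambda>x. f x *\<^sub>R g x) S"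
  using assms
proof (induction k arbitrary: f g)
  case 0
  then show ?case by (auto intro: continuous_intros)
next
  case (Suc k)
  have fg: "Ck_on k f S" "Ck_on k g S" using Suc.prems Ck_on_Suc_imp by blast+
  show ?case
  proof (rule Ck_on_SucI[OF Suc.prems(1) has_derivative_scaleR[OF
          Ck_on_Suc_has_derivative[OF Suc.prems(2)] Ck_on_Suc_has_derivative[OF Suc.prems(3)]]])
    fix v
    show "Ck_on k (\<lambda>x. f x *\<^sub>R frechet_derivative g (at x) v + frechet_derivative f (at x) v *\<^sub>R g x) S"
      using Suc.prems fg by (intro Ck_on_add Suc.IH) auto
  qed auto
qed

lemma Ck_on_inner:
  fixes f :: "'a::euclidean_space \<Rightarrow> 'b::euclidean_space"
  assumes "open S" "Ck_on k f S"
  shows "Ck_on k (\<lambda>x. f x \<bullet> b) S"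
  using assms
proof (induction k arbitrary: f)
  case 0
  then show ?case by (auto intro: continuous_intros)
next
  case (Suc k)
  show ?case
    by (rule Ck_on_SucI[OF Suc.prems(1) has_derivative_inner_left[OF
          Ck_on_Suc_has_derivative[OF Suc.prems(2)]]])
       (use Suc in auto)
qed

text \<open>The chain rule produces the derivative of \<open>f\<close> in the moving direction \<open>Dh x v\<close>, whereas
  \<^const>\<open>Ck_on\<close> speaks of fixed directions. Expanding \<open>Dh x v\<close> in the basis writes the derivative of
  the composition as a sum of products of \<open>C\<^sup>k\<close> functions, to which the induction hypothesis applies.\<close>

lemma Ck_on_compose:
  fixes f :: "'b::euclidean_space \<Rightarrow> 'c::euclidean_space" and h :: "'a::euclidean_space \<Rightarrow> 'b"
  assumes "open S" "Ck_on k f R" "Ck_on k h S" "h ` S \<subseteq> R"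
  shows "Ck_on k (\<lambda>x. f (h x)) S"
  using assms
proof (induction k arbitrary: f h)
  case 0
  then show ?case by (auto intro: continuous_on_compose2)
next
  case (Suc k)
  let ?Df = "\<lambda>x. frechet_derivative f (at x)" and ?Dh = "\<lambda>x. frechet_derivative h (at x)"
  have h: "Ck_on k h S" using Suc.prems Ck_on_Suc_imp by blast
  have dh: "(h has_derivative ?Dh x) (at x)" if "x \<in> S" for x
    using Ck_on_Suc_has_derivative[OF Suc.prems(3) that] .
  have df: "(f has_derivative ?Df (h x)) (at (h x))" if "x \<in> S" for x
    using Ck_on_Suc_has_derivative[OF Suc.prems(2)] Suc.prems(4) that by blast
  have comp: "((\<lambda>x. f (h x)) has_derivative (\<lambda>v. ?Df (h x) (?Dh x v))) (at x)" if "x \<in> S" for x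
    using has_derivative_compose[OF dh[OF that] df[OF that]] .
  have expand: "?Df (h x) (?Dh x v) = (\<Sum>b\<in>Basis. (?Dh x v \<bullet> b) *\<^sub>R ?Df (h x) b)" if "x \<in> S" for x v
    using has_derivative_linear[OF df[OF that]]
    by (subst euclidean_representation[of "?Dh x v", symmetric]) (simp add: linear_sum linear_cmul)
  have "Ck_on k (\<lambda>x. \<Sum>b\<in>Basis. (?Dh x v \<bullet> b) *\<^sub>R ?Df (h x) b) S" for v
  proof (intro Ck_on_sum Ck_on_scaleR Ck_on_inner Suc.prems(1))
    show "Ck_on k (\<lambda>x. ?Dh x v) S" using Suc.prems(3) by simp
    show "Ck_on k (\<lambda>x. ?Df (h x) b) S" for b
      using Suc.prems by (intro Suc.IH[OF _ _ h]) auto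
  qed
  then show ?case
    using expand by (intro Ck_on_SucI[OF Suc.prems(1) comp]) (auto simp: Ck_on_cong[OF Suc.prems(1) expand])
qed

text \<open>On open sets the local extensions in the definition of \<^const>\<open>smooth_on\<close> may be restricted to
  the set itself, where they agree with \<open>f\<close>.\<close>

lemma smooth_on_open_iff:
  assumes "open S"
  shows "smooth_on S f \<longleftrightarrow> (\<forall>k. Ck_on k f S)"
proof
  assume sm: "smooth_on S f"
  show "\<forall>k. Ck_on k f S"
  proof (intro allI Ck_on_local)
    fix k x assume "x \<in> S"
    then obtain W g where W: "open W" "x \<in> W" "\<forall>k. Ck_on k g W" "\<forall>y\<in>S \<inter> W. g y = f y"
      using sm unfolding smooth_on_def by blast
    have "Ck_on k f (S \<inter> W)"
      using W Ck_on_subset[of k g W "S \<inter> W"] Ck_on_cong[of "S \<inter> W" g f k] assms by auto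
    then show "\<exists>W. open W \<and> x \<in> W \<and> Ck_on k f W"
      using W \<open>x \<in> S\<close> assms by blast
  qed
next
  assume "\<forall>k. Ck_on k f S"
  then show "smooth_on S f" using assms unfolding smooth_on_def by blast
qed

lemma smooth_on_cong:
  assumes "open S" "\<And>x. x \<in> S \<Longrightarrow> f x = g x" "smooth_on S f"
  shows "smooth_on S g"
  using assms Ck_on_cong[OF assms(1,2)] by (simp add: smooth_on_open_iff)

lemma smooth_on_local:
  assumes "open S" "\<And>x. x \<in> S \<Longrightarrow> \<exists>W. open W \<and> x \<in> W \<and> smooth_on W f"
  shows "smooth_on S f"
  unfolding smooth_on_open_iff[OF assms(1)]
proof (intro allI Ck_on_local)
  fix k x assume "x \<in> S"
  then show "\<exists>W. open W \<and> x \<in> W \<and> Ck_on k f W"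
    using assms(2) smooth_on_open_iff by blast
qed

lemma smooth_on_compose:
  assumes "open S" "open R" "smooth_on R f" "smooth_on S h" "h ` S \<subseteq> R"
  shows "smooth_on S (\<lambda>x. f (h x))"
  using assms Ck_on_compose by (fastforce simp: smooth_on_open_iff)

lemma smooth_on_has_derivative:
  assumes "open S" "smooth_on S f" "x \<in> S"
  shows "(f has_derivative frechet_derivative f (at x)) (at x)"
  using assms Ck_on_Suc_has_derivative[of 0 f S x] by (simp add: smooth_on_open_iff del: Ck_on.simps)

lemma smooth_on_directional_derivative:
  assumes "open S" "smooth_on S f"
  shows "smooth_on S (\<lambda>x. frechet_derivative f (at x) v)"
  using assms by (auto simp: smooth_on_open_iff) (metis Ck_on.simps(2))

lemma smooth_on_affine: "bounded_linear L \<Longrightarrow> open S \<Longrightarrow> smooth_on S (\<lambda>x. c + L x)"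
  using Ck_on_affine[of L S _ c] smooth_on_open_iff[of S "\<lambda>x. c + L x"] by simp

text \<open>For curves on an interval with end points, smoothness gives only one-sided derivatives
  there, inherited from a local extension.\<close>

lemma smooth_on_differentiable_within:
  assumes "smooth_on S f" "x \<in> S"
  shows "f differentiable (at x within S)"
proof -
  obtain W g where W: "open W" "x \<in> W" "\<forall>k. Ck_on k g W" "\<forall>y\<in>S \<inter> W. g y = f y"
    using assms unfolding smooth_on_def by blast
  have "Ck_on (Suc 0) g W" using W(3) by blast
  then obtain D where D: "(g has_derivative D) (at x within S)"
    using Ck_on_Suc_has_derivative W(2) has_derivative_at_withinI by blast
  obtain e where "0 < e" "ball x e \<subseteq> W" using W openE by blast
  then have "(f has_derivative D) (at x within S)"
    by (intro has_derivative_transform_within[OF D _ assms(2)]) (use W(4) in \<open>auto simp: dist_commute subset_iff\<close>)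
  then show ?thesis by (auto simp: differentiable_def)
qed

section \<open>Symmetry of second derivatives\<close>

text \<open>Applying the mean value theorem first in direction \<open>u\<close> and then in direction \<open>v\<close> expresses a
  second difference by a mixed derivative at a nearby point. The second difference is symmetric in \<open>u\<close>
  and \<open>v\<close>, which is what \<open>symmetric_second_derivative\<close> exploits.\<close>

lemma second_difference_mean_value:
  fixes f :: "'a::euclidean_space \<Rightarrow> real"
  assumes f: "Ck_on 2 f S" and "0 < s"
    and seg: "\<And>a b. 0 \<le> a \<Longrightarrow> a \<le> s \<Longrightarrow> 0 \<le> b \<Longrightarrow> b \<le> s \<Longrightarrow> x + a *\<^sub>R u + b *\<^sub>R v \<in> S"
  shows "\<exists>a\<in>{0..s}. \<exists>b\<in>{0..s}.
    f (x + s *\<^sub>R u + s *\<^sub>R v) - f (x + s *\<^sub>R u) - f (x + s *\<^sub>R v) + f x =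
     s * (s * frechet_derivative (\<lambda>y. frechet_derivative f (at y) u) (at (x + a *\<^sub>R u + b *\<^sub>R v)) v)"
proof -
  let ?D = "\<lambda>y. frechet_derivative f (at y)"
  have C: "Ck_on (Suc (Suc 0)) f S" using f by (simp add: numeral_2_eq_2)
  have C1: "Ck_on (Suc 0) (\<lambda>y. ?D y u) S" using C by (metis Ck_on.simps(2))
  have df: "(f has_derivative ?D y) (at y)" if "y \<in> S" for y
    using Ck_on_Suc_has_derivative[OF C that] .
  have df1: "((\<lambda>r. f (x + r *\<^sub>R u + b *\<^sub>R v)) has_derivative (\<lambda>h. h * ?D (x + r *\<^sub>R u + b *\<^sub>R v) u)) (at r)"
    if "0 \<le> r" "r \<le> s" "0 \<le> b" "b \<le> s" for r b
  proof -
    let ?y = "x + r *\<^sub>R u + b *\<^sub>R v"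
    have "((\<lambda>r. x + r *\<^sub>R u + b *\<^sub>R v) has_derivative (\<lambda>h. h *\<^sub>R u)) (at r)"
      by (auto intro!: derivative_eq_intros)
    from has_derivative_compose[OF this df[OF seg[OF that]]]
    show ?thesis
      using linear_cmul[OF has_derivative_linear[OF df[OF seg[OF that]]]] by simp
  qed
  define g where "g r = f (x + r *\<^sub>R u + s *\<^sub>R v) - f (x + r *\<^sub>R u + 0 *\<^sub>R v)" for r
  have "(g has_derivative (\<lambda>h. h * ?D (x + r *\<^sub>R u + s *\<^sub>R v) u - h * ?D (x + r *\<^sub>R u + 0 *\<^sub>R v) u)) (at r within {0..s})"
    if "0 \<le> r" "r \<le> s" for r
    unfolding g_def[abs_def]
    by (rule has_derivative_at_withinI, rule has_derivative_diff[OF df1[of r s] df1[of r 0]])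
       (use that \<open>0 < s\<close> in auto)
  from mvt_simple[OF \<open>0 < s\<close> this] obtain a where a: "0 < a" "a < s"
    "g s - g 0 = s * ?D (x + a *\<^sub>R u + s *\<^sub>R v) u - s * ?D (x + a *\<^sub>R u + 0 *\<^sub>R v) u" by auto
  let ?P = "\<lambda>y. frechet_derivative (\<lambda>y. ?D y u) (at y) v"
  have "((\<lambda>r. ?D (x + a *\<^sub>R u + r *\<^sub>R v) u) has_derivative (\<lambda>h. h * ?P (x + a *\<^sub>R u + r *\<^sub>R v))) (at r within {0..s})"
    if "0 \<le> r" "r \<le> s" for r
  proof -
    let ?y = "x + a *\<^sub>R u + r *\<^sub>R v"
    have y: "?y \<in> S" using that a seg by auto
    have "((\<lambda>r. x + a *\<^sub>R u + r *\<^sub>R v) has_derivative (\<lambda>h. h *\<^sub>R v)) (at r)"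
      by (auto intro!: derivative_eq_intros)
    from has_derivative_compose[OF this Ck_on_Suc_has_derivative[OF C1 y]]
    show ?thesis
      using linear_cmul[OF has_derivative_linear[OF Ck_on_Suc_has_derivative[OF C1 y]]]
      by (auto intro: has_derivative_at_withinI)
  qed
  from mvt_simple[OF \<open>0 < s\<close> this] obtain b where b: "0 < b" "b < s"
    "?D (x + a *\<^sub>R u + s *\<^sub>R v) u - ?D (x + a *\<^sub>R u + 0 *\<^sub>R v) u = s * ?P (x + a *\<^sub>R u + b *\<^sub>R v)" by auto
  have "g s - g 0 = s * (s * ?P (x + a *\<^sub>R u + b *\<^sub>R v))"
    using a(3) b(3) by (simp add: right_diff_distrib[symmetric])
  moreover have "a \<in> {0..s}" "b \<in> {0..s}" using a b by auto
  moreover have "g s - g 0 = f (x + s *\<^sub>R u + s *\<^sub>R v) - f (x + s *\<^sub>R u) - f (x + s *\<^sub>R v) + f x"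
    by (simp add: g_def)
  ultimately show ?thesis by (metis (no_types, lifting))
qed

text \<open>Both mixed derivatives take the same value, the normalised second difference, at points
  arbitrarily close to \<open>x\<close>; continuity does the rest.\<close>

lemma symmetric_second_derivative:
  fixes f :: "'a::euclidean_space \<Rightarrow> real"
  assumes f: "Ck_on 2 f S" and "open S" "x \<in> S"
  shows "frechet_derivative (\<lambda>y. frechet_derivative f (at y) u) (at x) v
       = frechet_derivative (\<lambda>y. frechet_derivative f (at y) v) (at x) u"
proof -
  define P where "P u v = (\<lambda>y. frechet_derivative (\<lambda>y. frechet_derivative f (at y) u) (at y) v)" for u v
  have C: "Ck_on (Suc (Suc 0)) f S" using f by (simp add: numeral_2_eq_2)
  have cont: "continuous_on S (P u v)" for u v using C by (auto simp: P_def)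
  obtain r where r: "0 < r" "ball x r \<subseteq> S" using assms openE by blast
  have "\<bar>P u v x - P v u x\<bar> \<le> e" if "0 < e" for e
  proof -
    have near: "\<exists>d>0. \<forall>y. dist y x < d \<longrightarrow> dist (P u v y) (P u v x) < e / 2" for u v
    proof -
      have "continuous (at x) (P u v)" using cont assms by (simp add: continuous_on_eq_continuous_at)
      then show ?thesis using half_gt_zero[OF \<open>0 < e\<close>] unfolding continuous_at_eps_delta by blast
    qed
    obtain d1 where d1: "d1 > 0" "\<And>y. dist y x < d1 \<Longrightarrow> dist (P u v y) (P u v x) < e / 2"
      using near[of u v] by blast
    obtain d2 where d2: "d2 > 0" "\<And>y. dist y x < d2 \<Longrightarrow> dist (P v u y) (P v u x) < e / 2"
      using near[of v u] by blast
    define d where "d = min r (min d1 d2)"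
    have "d > 0" using r d1 d2 by (simp add: d_def)
    \<comment> \<open>The parallelogram with sides \<open>s u\<close> and \<open>s v\<close> stays within distance \<open>d\<close> of \<open>x\<close>; adding \<open>1\<close> covers \<open>u = v = 0\<close>.\<close>
    define s where "s = d / (norm u + norm v + 1)"
    have "s > 0" using \<open>d > 0\<close> by (simp add: s_def add_nonneg_pos)
    have "s * (norm u + norm v + 1) = d"
      using norm_ge_zero[of u] norm_ge_zero[of v] unfolding s_def
      by (metis add.commute add_nonneg_pos add_nonneg_nonneg nonzero_eq_divide_eq less_irrefl zero_less_one)
    then have sd: "s * (norm u + norm v) < d" using \<open>s > 0\<close> by (simp add: distrib_left)
    have close: "dist (x + a *\<^sub>R w + b *\<^sub>R z) x < d" if "0 \<le> a" "a \<le> s" "0 \<le> b" "b \<le> s"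
      "norm w + norm z = norm u + norm v" for a b w z
    proof -
      have "dist (x + a *\<^sub>R w + b *\<^sub>R z) x \<le> norm (a *\<^sub>R w) + norm (b *\<^sub>R z)"
        by (simp add: dist_norm norm_triangle_le add.assoc norm_triangle_ineq del: norm_scaleR)
      also have "\<dots> \<le> s * norm w + s * norm z" using that by (simp add: add_mono mult_right_mono)
      also have "\<dots> < d" using sd that by (simp add: distrib_left[symmetric])
      finally show ?thesis .
    qed
    have inS: "x + a *\<^sub>R w + b *\<^sub>R z \<in> S" if "0 \<le> a" "a \<le> s" "0 \<le> b" "b \<le> s"
      "norm w + norm z = norm u + norm v" for a b w z
      using close[OF that] r by (auto simp: d_def dist_commute subset_iff)
    obtain a b where ab: "0 \<le> a" "a \<le> s" "0 \<le> b" "b \<le> s" and D1: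
      "f (x + s *\<^sub>R u + s *\<^sub>R v) - f (x + s *\<^sub>R u) - f (x + s *\<^sub>R v) + f x = s * (s * P u v (x + a *\<^sub>R u + b *\<^sub>R v))"
      using second_difference_mean_value[OF f \<open>s > 0\<close> inS, of u v] unfolding P_def by auto
    obtain a' b' where ab': "0 \<le> a'" "a' \<le> s" "0 \<le> b'" "b' \<le> s" and D2:
      "f (x + s *\<^sub>R v + s *\<^sub>R u) - f (x + s *\<^sub>R v) - f (x + s *\<^sub>R u) + f x = s * (s * P v u (x + a' *\<^sub>R v + b' *\<^sub>R u))"
      using second_difference_mean_value[OF f \<open>s > 0\<close> inS, of v u] unfolding P_def by (auto simp: add.commute)
    have "s * (s * P u v (x + a *\<^sub>R u + b *\<^sub>R v)) = s * (s * P v u (x + a' *\<^sub>R v + b' *\<^sub>R u))"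
      using D1 D2 by (simp add: algebra_simps)
    then have eq: "P u v (x + a *\<^sub>R u + b *\<^sub>R v) = P v u (x + a' *\<^sub>R v + b' *\<^sub>R u)" using \<open>s > 0\<close> by simp
    have "dist (P u v (x + a *\<^sub>R u + b *\<^sub>R v)) (P u v x) < e / 2"
      using close[OF ab, of u v] by (intro d1) (auto simp: d_def)
    moreover have "dist (P v u (x + a' *\<^sub>R v + b' *\<^sub>R u)) (P v u x) < e / 2"
      using close[OF ab', of v u] by (intro d2) (auto simp: d_def)
    ultimately show ?thesis using eq unfolding dist_real_def by linarith
  qed
  then have "\<bar>P u v x - P v u x\<bar> \<le> 0" using field_le_epsilon[of "\<bar>P u v x - P v u x\<bar>" 0] by simp
  then show ?thesis by (simp add: P_def)
qed

section \<open>The Frenet equations in three-space\<close>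

lemma positive_orthonormal_cross:
  fixes t n b :: "real^3"
  assumes "t \<bullet> t = 1" "n \<bullet> n = 1" "b \<bullet> b = 1" "t \<bullet> n = 0" "t \<bullet> b = 0" "n \<bullet> b = 0"
    and "det (vector [t, n, b] :: real^3^3) > 0"
  shows "cross3 t n = b" "cross3 n b = t" "cross3 b t = n"
proof -
  have main: "cross3 x y = z"
    if "x \<bullet> x = 1" "y \<bullet> y = 1" "z \<bullet> z = 1" "x \<bullet> y = 0" "x \<bullet> z = 0" "y \<bullet> z = 0" "cross3 x y \<bullet> z > 0"
    for x y z :: "real^3"
  proof -
    let ?c = "cross3 x y"
    have "norm x = 1" "norm y = 1" using that by (simp_all add: norm_eq_1)
    then have cc: "?c \<bullet> ?c = 1"
      using norm_cross_dot[of x y] that by (simp add: power2_norm_eq_inner)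
    \<comment> \<open>\<open>z\<close> is orthogonal to \<open>x\<close> and \<open>y\<close>, hence parallel to their cross product.\<close>
    have "cross3 ?c z = (x \<bullet> z) *\<^sub>R y - (y \<bullet> z) *\<^sub>R x"
      by (simp add: cross3_simps forall_3)
    then have "cross3 ?c z = 0" using that by simp
    then have "(?c \<bullet> z)\<^sup>2 = 1"
      using norm_cross_dot[of ?c z] cc that(3) by (simp add: norm_eq_1[symmetric])
    then have "?c \<bullet> z = 1" using that(7) by (simp add: power2_eq_1_iff)
    then have "(?c - z) \<bullet> (?c - z) = 0" using cc that by (simp add: inner_diff_left inner_diff_right inner_commute)
    then show ?thesis by simp
  qed
  have "cross3 t n \<bullet> b > 0" "cross3 n b \<bullet> t > 0" "cross3 b t \<bullet> n > 0"
    using assms(7) by (simp_all add: cross3_simps)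
  with assms show "cross3 t n = b" "cross3 n b = t" "cross3 b t = n"
    by (simp_all add: main inner_commute)
qed

text \<open>The Frenet equations of a curve in Euclidean three-space with positively oriented frame; \<open>\<mu>\<close> is
  the torsion. For a curve in the group, \<open>\<mu>\<close> will be the torsion minus the Lie group torsion.\<close>

definition frenet_equations ::
  "real set \<Rightarrow> (real \<Rightarrow> real^3) \<Rightarrow> (real \<Rightarrow> real^3) \<Rightarrow> (real \<Rightarrow> real^3) \<Rightarrow>
   (real \<Rightarrow> real) \<Rightarrow> (real \<Rightarrow> real) \<Rightarrow> bool" where
  "frenet_equations I t n b \<kappa> \<mu> \<longleftrightarrow> (\<forall>s\<in>I. 0 < \<kappa> s \<and>
     t s \<bullet> t s = 1 \<and> n s \<bullet> n s = 1 \<and> b s \<bullet> b s = 1 \<and>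
     t s \<bullet> n s = 0 \<and> t s \<bullet> b s = 0 \<and> n s \<bullet> b s = 0 \<and>
     det (vector [t s, n s, b s] :: real^3^3) > 0 \<and>
     (t has_vector_derivative \<kappa> s *\<^sub>R n s) (at s within I) \<and>
     (n has_vector_derivative - \<kappa> s *\<^sub>R t s + \<mu> s *\<^sub>R b s) (at s within I) \<and>
     (b has_vector_derivative - \<mu> s *\<^sub>R n s) (at s within I))"

lemma frenet_equationsD:
  assumes "frenet_equations I t n b \<kappa> \<mu>" and "s \<in> I"
  shows "0 < \<kappa> s"
    and "t s \<bullet> t s = 1" "n s \<bullet> n s = 1" "b s \<bullet> b s = 1"
    and "t s \<bullet> n s = 0" "t s \<bullet> b s = 0" "n s \<bullet> b s = 0"
    and "det (vector [t s, n s, b s] :: real^3^3) > 0"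
    and "(t has_vector_derivative \<kappa> s *\<^sub>R n s) (at s within I)"
    and "(n has_vector_derivative - \<kappa> s *\<^sub>R t s + \<mu> s *\<^sub>R b s) (at s within I)"
    and "(b has_vector_derivative - \<mu> s *\<^sub>R n s) (at s within I)"
  using assms unfolding frenet_equations_def by blast+

lemma frenet_equations_cross:
  assumes "frenet_equations I t n b \<kappa> \<mu>" and "s \<in> I"
  shows "cross3 (t s) (n s) = b s" "cross3 (n s) (b s) = t s"
  using positive_orthonormal_cross[OF frenet_equationsD(2-8)[OF assms]] by blast+

text \<open>Expanding the triple product \<open>(t \<times> n) \<times> w\<close> shows that \<open>w\<close> is parallel to \<open>b\<close>; it is also orthogonal
  to \<open>b\<close>.\<close>

lemma orthogonal_to_frame_eq_0:
  fixes t n b w :: "real^3"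
  assumes "b \<bullet> b = 1" and "cross3 t n = b" and "w \<bullet> t = 0" "w \<bullet> n = 0" "w \<bullet> b = 0"
  shows "w = 0"
proof -
  have "cross3 (cross3 t n) w = (t \<bullet> w) *\<^sub>R n - (n \<bullet> w) *\<^sub>R t" by (simp add: cross3_simps forall_3)
  then have "cross3 b w = 0" using assms by (simp add: inner_commute)
  then show ?thesis using norm_cross_dot[of b w] assms by (simp add: inner_commute norm_eq_1[symmetric])
qed

text \<open>Guarantees that derivatives within the interval, one-sided ones included, are unique.\<close>

lemma interval_not_isolated:
  assumes "is_interval I" "interior I \<noteq> {}" "s \<in> (I :: real set)"
  shows "at s within I \<noteq> bot"
proof -
  have "I \<noteq> {s}" using assms(2) by auto
  then show ?thesis
    using connected_imp_perfect[of I s] assms is_interval_connected trivial_limit_within by blast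
qed

lemma vector_derivative_unique_on:
  assumes "at s within I \<noteq> bot" "s \<in> I" "\<And>r. r \<in> I \<Longrightarrow> f r = g r"
    and "(f has_vector_derivative D) (at s within I)" "(g has_vector_derivative E) (at s within I)"
  shows "D = E"
proof -
  have "(g has_vector_derivative D) (at s within I)"
    by (rule has_vector_derivative_transform[OF assms(2) _ assms(4)]) (simp add: assms(3))
  then show ?thesis using vector_derivative_unique_within[OF assms(1)] assms(5) by blast
qed

text \<open>The derivative of the tangent gives \<open>\<kappa>\<close> as its norm, and then the normal; orientation gives
  the binormal, and the derivative of the normal gives \<open>\<mu>\<close>.\<close>

lemma frenet_unique:
  assumes I: "\<And>s. s \<in> I \<Longrightarrow> at s within I \<noteq> bot"
    and F: "frenet_equations I t n b \<kappa> \<mu>" and F': "frenet_equations I t' n' b' \<kappa>' \<mu>'"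
    and t: "\<And>s. s \<in> I \<Longrightarrow> t s = t' s" and s: "s \<in> I"
  shows "\<kappa> s = \<kappa>' s" and "\<mu> s = \<mu>' s"
proof -
  have kn: "\<kappa> s = \<kappa>' s \<and> n s = n' s" if s: "s \<in> I" for s
  proof -
    have eq: "\<kappa> s *\<^sub>R n s = \<kappa>' s *\<^sub>R n' s"
      by (rule vector_derivative_unique_on[OF I[OF s] s t frenet_equationsD(9)[OF F s] frenet_equationsD(9)[OF F' s]])
    have "norm (n s) = 1" "norm (n' s) = 1"
      using frenet_equationsD(3)[OF F s] frenet_equationsD(3)[OF F' s] by (simp_all add: norm_eq_1)
    then have "\<kappa> s = \<kappa>' s"
      using arg_cong[OF eq, of norm] frenet_equationsD(1)[OF F s] frenet_equationsD(1)[OF F' s] by simp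
    then show ?thesis using eq frenet_equationsD(1)[OF F s] by simp
  qed
  then show "\<kappa> s = \<kappa>' s" using s by blast
  have b: "b s = b' s"
    using frenet_equations_cross(1)[OF F s] frenet_equations_cross(1)[OF F' s] t[OF s] kn[OF s] by simp
  have "- \<kappa> s *\<^sub>R t s + \<mu> s *\<^sub>R b s = - \<kappa>' s *\<^sub>R t' s + \<mu>' s *\<^sub>R b' s"
    by (rule vector_derivative_unique_on[OF I[OF s] s _ frenet_equationsD(10)[OF F s] frenet_equationsD(10)[OF F' s]])
       (simp add: kn)
  then have "\<mu> s *\<^sub>R b s = \<mu>' s *\<^sub>R b s" using b t[OF s] kn[OF s] by simp
  moreover have "b s \<noteq> 0" using frenet_equationsD(4)[OF F s] by force
  ultimately show "\<mu> s = \<mu>' s" by simp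
qed

text \<open>Comparing the two expressions for the derivative of \<open>n = t'\<close> gives
  \<open>\<kappa>' n' = - \<kappa> t + \<mu> b\<close>, hence \<open>\<mu> / \<kappa> = - (n' \<bullet> b) / (n' \<bullet> t)\<close>. The right-hand side contains only
  frame vectors, whose derivatives are known; differentiability of \<open>\<kappa>\<close> and \<open>\<mu>\<close> comes for free.\<close>

lemma natural_mate_ratio_derivative:
  assumes I: "\<And>s. s \<in> I \<Longrightarrow> at s within I \<noteq> bot"
    and F: "frenet_equations I t n b \<kappa> \<mu>" and F': "frenet_equations I t' n' b' \<kappa>' \<mu>'"
    and t'_eq: "\<And>s. s \<in> I \<Longrightarrow> t' s = n s" and s: "s \<in> I"
  shows "((\<lambda>r. \<mu> r / \<kappa> r) has_real_derivative \<mu>' s * (\<kappa>' s)\<^sup>2 / (\<kappa> s)\<^sup>2) (at s within I)"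
proof -
  note on = frenet_equationsD(2-7)[OF F] and pos = frenet_equationsD(1)[OF F] frenet_equationsD(1)[OF F']
  have mate: "\<kappa>' r *\<^sub>R n' r = - \<kappa> r *\<^sub>R t r + \<mu> r *\<^sub>R b r" if "r \<in> I" for r
    by (rule vector_derivative_unique_on[OF I[OF that] that t'_eq
          frenet_equationsD(9)[OF F' that] frenet_equationsD(10)[OF F that]])
  have n': "(n' has_vector_derivative - \<kappa>' s *\<^sub>R n s + \<mu>' s *\<^sub>R b' s) (at s within I)"
    using frenet_equationsD(10)[OF F' s] t'_eq[OF s] by metis
  note t = frenet_equationsD(9)[OF F s] and b = frenet_equationsD(11)[OF F s]
  have n'n': "n' s \<bullet> n' s = 1" "n s \<bullet> n' s = 0"
    using frenet_equationsD(3,5)[OF F' s] t'_eq[OF s] by simp_all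
  have cross: "cross3 (t s) (n s) = b s" "cross3 (n s) (b s) = t s" "cross3 (n s) (n' s) = b' s"
    using frenet_equations_cross[OF F s] frenet_equations_cross(1)[OF F' s] t'_eq[OF s] by simp_all
  have n't: "n' r \<bullet> t r = - \<kappa> r / \<kappa>' r" and n'b: "n' r \<bullet> b r = \<mu> r / \<kappa>' r" if "r \<in> I" for r
  proof -
    have "\<kappa>' r * (n' r \<bullet> t r) = - \<kappa> r" "\<kappa>' r * (n' r \<bullet> b r) = \<mu> r"
      using arg_cong[OF mate[OF that], of "\<lambda>x. x \<bullet> t r"] arg_cong[OF mate[OF that], of "\<lambda>x. x \<bullet> b r"] on[OF that]
      by (simp_all add: inner_diff_right inner_diff_left inner_commute)
    then show "n' r \<bullet> t r = - \<kappa> r / \<kappa>' r" "n' r \<bullet> b r = \<mu> r / \<kappa>' r"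
      using pos(2)[OF that] by (simp_all add: field_simps)
  qed
  have ratio: "\<mu> r / \<kappa> r = - (n' r \<bullet> b r) / (n' r \<bullet> t r)" if "r \<in> I" for r
    using pos[OF that] by (simp add: n't n'b that)
  \<comment> \<open>The tangent of the mate is \<open>n\<close>, so its binormal is \<open>n \<times> n'\<close>.\<close>
  have "\<kappa>' s *\<^sub>R b' s = cross3 (n s) (\<kappa>' s *\<^sub>R n' s)"
    by (simp add: cross(3)[symmetric] cross_mult_right)
  also have "\<dots> = - \<kappa> s *\<^sub>R cross3 (n s) (t s) + \<mu> s *\<^sub>R cross3 (n s) (b s)"
    unfolding mate[OF s] by (simp only: cross_add_right cross_mult_right)
  also have "\<dots> = \<kappa> s *\<^sub>R b s + \<mu> s *\<^sub>R t s"
    using cross cross_skew[of "n s" "t s"] by simp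
  finally have b': "\<kappa>' s *\<^sub>R b' s = \<kappa> s *\<^sub>R b s + \<mu> s *\<^sub>R t s" .
  have "\<kappa>' s * (b' s \<bullet> t s) = \<mu> s" "\<kappa>' s * (b' s \<bullet> b s) = \<kappa> s"
    using arg_cong[OF b', of "\<lambda>x. x \<bullet> t s"] arg_cong[OF b', of "\<lambda>x. x \<bullet> b s"] on[OF s]
    by (simp_all add: inner_add_right inner_add_left inner_commute)
  then have b't: "b' s \<bullet> t s = \<mu> s / \<kappa>' s" and b'b: "b' s \<bullet> b s = \<kappa> s / \<kappa>' s"
    using pos(2)[OF s] by (simp_all add: field_simps)
  have sq: "(\<kappa>' s)\<^sup>2 = (\<kappa> s)\<^sup>2 + (\<mu> s)\<^sup>2"
  proof -
    have "(\<kappa>' s *\<^sub>R n' s) \<bullet> (\<kappa>' s *\<^sub>R n' s) = (\<kappa>' s)\<^sup>2" using n'n' by (simp add: power2_eq_square)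
    then show ?thesis unfolding mate[OF s] using on[OF s]
      by (simp add: inner_diff_left inner_diff_right inner_add_left inner_add_right inner_commute power2_eq_square)
  qed
  have dt: "((\<lambda>r. n' r \<bullet> t r) has_real_derivative \<mu>' s * \<mu> s / \<kappa>' s) (at s within I)"
    using bounded_bilinear.has_vector_derivative[OF bounded_bilinear_inner n' t] on[OF s] n'n' b't
    by (simp add: has_real_derivative_iff_has_vector_derivative inner_diff_left inner_diff_right inner_add_left inner_add_right inner_commute)
  have db: "((\<lambda>r. n' r \<bullet> b r) has_real_derivative \<mu>' s * \<kappa> s / \<kappa>' s) (at s within I)"
    using bounded_bilinear.has_vector_derivative[OF bounded_bilinear_inner n' b] on[OF s] n'n' b'b
    by (simp add: has_real_derivative_iff_has_vector_derivative inner_diff_left inner_diff_right inner_add_left inner_add_right inner_commute)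
  have k: "\<kappa> s \<noteq> 0" "\<kappa>' s \<noteq> 0" using pos[OF s] by auto
  have nz: "n' s \<bullet> t s \<noteq> 0" using k by (simp add: n't s)
  have "((\<lambda>r. - (n' r \<bullet> b r) / (n' r \<bullet> t r)) has_real_derivative
      \<mu>' s * ((\<kappa> s)\<^sup>2 + (\<mu> s)\<^sup>2) / (\<kappa> s)\<^sup>2) (at s within I)"
    by (rule DERIV_cong[OF DERIV_divide[OF DERIV_minus[OF db] dt nz]])
       (use k in \<open>simp add: n't n'b s field_simps power2_eq_square\<close>)
  then have "((\<lambda>r. - (n' r \<bullet> b r) / (n' r \<bullet> t r)) has_real_derivative
      \<mu>' s * (\<kappa>' s)\<^sup>2 / (\<kappa> s)\<^sup>2) (at s within I)" unfolding sq .
  then show ?thesis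
    by (rule has_field_derivative_transform_within[OF _ zero_less_one s]) (simp add: ratio)
qed

lemma affine_iff_constant_derivative:
  fixes h h' :: "real \<Rightarrow> real"
  assumes I: "is_interval I" "interior I \<noteq> {}"
    and h: "\<And>s. s \<in> I \<Longrightarrow> (h has_real_derivative h' s) (at s within I)"
  shows "(\<exists>b. \<forall>s\<in>I. h s = a * s + b) \<longleftrightarrow> (\<forall>s\<in>I. h' s = a)"
proof
  assume "\<exists>b. \<forall>s\<in>I. h s = a * s + b"
  then obtain b where b: "\<And>s. s \<in> I \<Longrightarrow> h s = a * s + b" by blast
  show "\<forall>s\<in>I. h' s = a"
  proof
    fix s assume s: "s \<in> I"
    have "((\<lambda>s. a * s + b) has_real_derivative a) (at s within I)" by (auto intro!: derivative_eq_intros)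
    then show "h' s = a"
      using vector_derivative_unique_on[OF interval_not_isolated[OF I s] s b, where D = "h' s" and E = a] h[OF s]
      by (simp add: has_real_derivative_iff_has_vector_derivative)
  qed
next
  assume a: "\<forall>s\<in>I. h' s = a"
  have "((\<lambda>s. h s - a * s) has_real_derivative 0) (at s within I)" if "s \<in> I" for s
    by (rule DERIV_cong[OF DERIV_diff[OF h[OF that] DERIV_cmult[OF DERIV_ident]]]) (use a that in simp)
  then obtain b where "\<And>s. s \<in> I \<Longrightarrow> h s - a * s = b"
    using has_field_derivative_zero_constant[of I "\<lambda>s. h s - a * s"] is_interval_convex[OF I(1)] by blast
  then have "\<forall>s\<in>I. h s = a * s + b" by (simp add: algebra_simps)
  then show "\<exists>b. \<forall>s\<in>I. h s = a * s + b" ..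
qed

section \<open>Charts and tangent vectors\<close>

lemma chart_open:
  assumes "(U, \<phi>) \<in> (atlas :: ('g::lie_group_3 set \<times> ('g \<Rightarrow> real^3)) set)"
  shows "open U" and "open (\<phi> ` U)" and "open V \<Longrightarrow> open (\<phi> ` (U \<inter> V))"
  using chart_homeomorphism[OF assms] by auto

lemma chart_inverse:
  assumes "(U, \<phi>) \<in> (atlas :: ('g::lie_group_3 set \<times> ('g \<Rightarrow> real^3)) set)"
  shows "x \<in> \<phi> ` U \<Longrightarrow> inv_into U \<phi> x \<in> U" and "x \<in> \<phi> ` U \<Longrightarrow> \<phi> (inv_into U \<phi> x) = x"
    and "p \<in> U \<Longrightarrow> inv_into U \<phi> (\<phi> p) = p"
  using chart_homeomorphism[OF assms] by (auto simp: inv_into_into f_inv_into_f)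

lemma chart_inverse_continuous:
  assumes "(U, \<phi>) \<in> (atlas :: ('g::lie_group_3 set \<times> ('g \<Rightarrow> real^3)) set)"
  shows "continuous_on (\<phi> ` U) (inv_into U \<phi>)"
  unfolding continuous_on_open_vimage[OF chart_open(2)[OF assms]]
proof (intro allI impI)
  fix B :: "'g set" assume "open B"
  moreover have "inv_into U \<phi> -` B \<inter> \<phi> ` U = \<phi> ` (U \<inter> B)"
    using chart_inverse[OF assms] by force
  ultimately show "open (inv_into U \<phi> -` B \<inter> \<phi> ` U)" using chart_open[OF assms] by simp
qed

lemma smooth_fun_chart:
  "smooth_fun f \<Longrightarrow> (U, \<phi>) \<in> atlas \<Longrightarrow> smooth_on (\<phi> ` U) (\<lambda>x. f (inv_into U \<phi> x))"
  by (auto simp: smooth_fun_def)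

lemma smooth_fun_const: "smooth_fun (\<lambda>_. c :: real)"
  unfolding smooth_fun_def by clarify (simp add: smooth_on_open_iff[OF chart_open(2)] Ck_on_const)

lemma smooth_fun_add: "smooth_fun f \<Longrightarrow> smooth_fun g \<Longrightarrow> smooth_fun (\<lambda>p. f p + g p)"
  unfolding smooth_fun_def
  by clarify (force simp: smooth_on_open_iff[OF chart_open(2)] intro: Ck_on_add[OF chart_open(2)])

lemma smooth_fun_mult: "smooth_fun f \<Longrightarrow> smooth_fun g \<Longrightarrow> smooth_fun (\<lambda>p. f p * g p)"
  unfolding smooth_fun_def
  by clarify (force simp: smooth_on_open_iff[OF chart_open(2)]
      intro: Ck_on_scaleR[OF chart_open(2), where 'b = real, unfolded real_scaleR_def])

text \<open>The derivation with components \<open>w\<close> in the chart \<open>\<phi>\<close> at \<open>p\<close>, with the same default value \<open>0\<close> on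
  functions that are not smooth as \<^const>\<open>velocity\<close>.\<close>

definition chart_vector ::
  "'g::lie_group_3 set \<Rightarrow> ('g \<Rightarrow> real^3) \<Rightarrow> 'g \<Rightarrow> real^3 \<Rightarrow> 'g tvec" where
  "chart_vector U \<phi> p w =
     (\<lambda>f. if smooth_fun f then frechet_derivative (\<lambda>x. f (inv_into U \<phi> x)) (at (\<phi> p)) w else 0)"

lemma chart_derivative:
  assumes "(U, \<phi>) \<in> atlas" "p \<in> U" "smooth_fun f"
  shows "((\<lambda>x. f (inv_into U \<phi> x)) has_derivative (\<lambda>w. chart_vector U \<phi> p w f)) (at (\<phi> p))"
  using smooth_on_has_derivative[OF chart_open(2)[OF assms(1)] smooth_fun_chart[OF assms(3,1)]] assms
  by (simp add: chart_vector_def)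

lemma chart_vector_linear:
  assumes "(U, \<phi>) \<in> atlas" "p \<in> U"
  shows "linear (\<lambda>w. chart_vector U \<phi> p w f)"
proof (cases "smooth_fun f")
  case True
  then show ?thesis using has_derivative_linear[OF chart_derivative[OF assms]] by simp
next
  case False
  then show ?thesis by (simp add: chart_vector_def linear_zero)
qed

lemma velocity_eq_chart_vector:
  assumes c: "smooth_curve I c" and "open I" "t \<in> I" and U: "(U, \<phi>) \<in> atlas" "c t \<in> U"
  shows "velocity I c t = chart_vector U \<phi> (c t) (vector_derivative (\<lambda>s. \<phi> (c s)) (at t))"
proof
  fix f
  define J where "J = {s \<in> I. c s \<in> U}"
  have "J = c -` U \<inter> I" by (auto simp: J_def)
  then have J: "open J" "t \<in> J"
    using c \<open>open I\<close> chart_open(1)[OF U(1)] continuous_on_open_vimage[OF \<open>open I\<close>, of c] assms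
    by (auto simp: smooth_curve_def)
  define v where "v = vector_derivative (\<lambda>s. \<phi> (c s)) (at t)"
  have "smooth_on J (\<lambda>s. \<phi> (c s))" using c U by (auto simp: smooth_curve_def J_def)
  then have "(\<lambda>s. \<phi> (c s)) differentiable (at t)"
    using smooth_on_has_derivative[OF J(1) _ J(2)] differentiable_def by blast
  then have v: "((\<lambda>s. \<phi> (c s)) has_derivative (\<lambda>h. h *\<^sub>R v)) (at t)"
    by (simp add: v_def vector_derivative_works[symmetric] has_vector_derivative_def[symmetric])
  show "velocity I c t f = chart_vector U \<phi> (c t) v f"
  proof (cases "smooth_fun f")
    case True
    have "((\<lambda>s. f (inv_into U \<phi> (\<phi> (c s)))) has_derivative (\<lambda>h. chart_vector U \<phi> (c t) (h *\<^sub>R v) f)) (at t)"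
      using has_derivative_compose[OF v chart_derivative[OF U True]] .
    then have "((\<lambda>s. f (inv_into U \<phi> (\<phi> (c s)))) has_vector_derivative chart_vector U \<phi> (c t) v f) (at t)"
      by (simp add: has_vector_derivative_def linear_cmul[OF chart_vector_linear[OF U]])
    then have "((\<lambda>s. f (c s)) has_vector_derivative chart_vector U \<phi> (c t) v f) (at t)"
      by (rule has_vector_derivative_transform_within_open[OF _ J])
         (simp add: J_def chart_inverse(3)[OF U(1)])
    from vector_derivative_at[OF this] show ?thesis
      using True by (simp add: velocity_def at_within_open[OF \<open>t \<in> I\<close> \<open>open I\<close>])
  qed (simp add: velocity_def chart_vector_def)
qed

text \<open>The curve with this velocity is a straight line in the chart, so its smoothness in other charts
  is that of a transition map.\<close>

lemma chart_vector_in_tangent_space: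
  assumes U: "(U, \<phi>) \<in> atlas" and p: "p \<in> U"
  shows "chart_vector U \<phi> p w \<in> tangent_space p"
proof -
  obtain r where r: "0 < r" "ball (\<phi> p) r \<subseteq> \<phi> ` U"
    using chart_open(2)[OF U] p by (meson openE imageI)
  \<comment> \<open>The line stays in the ball of radius \<open>r\<close>; adding \<open>1\<close> covers \<open>w = 0\<close>.\<close>
  define \<epsilon> where "\<epsilon> = r / (norm w + 1)"
  have "0 < \<epsilon>" using r by (simp add: \<epsilon>_def add_nonneg_pos)
  let ?I = "{-\<epsilon><..<\<epsilon>}"
  define l where "l t = \<phi> p + t *\<^sub>R w" for t
  define c where "c t = inv_into U \<phi> (l t)" for t
  have nw: "norm w + 1 > 0" by (simp add: add_nonneg_pos)
  have l: "l t \<in> \<phi> ` U" if "t \<in> ?I" for t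
  proof -
    have "\<bar>t\<bar> * norm w \<le> \<bar>t\<bar> * (norm w + 1)" by (simp add: mult_left_mono)
    also have "\<dots> < \<epsilon> * (norm w + 1)" using that nw by (intro mult_strict_right_mono) auto
    also have "\<dots> = r" using nw by (simp add: \<epsilon>_def)
    finally have "l t \<in> ball (\<phi> p) r" by (simp add: l_def dist_norm)
    then show ?thesis using r by blast
  qed
  have "continuous_on ?I c" unfolding c_def
    by (rule continuous_on_compose2[OF chart_inverse_continuous[OF U]])
       (use l in \<open>auto simp: l_def intro!: continuous_intros\<close>)
  moreover have "smooth_on {t \<in> ?I. c t \<in> V} (\<lambda>t. \<psi> (c t))" if V: "(V, \<psi>) \<in> atlas" for V \<psi>
  proof -
    have eq: "{t \<in> ?I. c t \<in> V} = c -` V \<inter> ?I" by auto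
    have o: "open {t \<in> ?I. c t \<in> V}"
      unfolding eq using \<open>continuous_on ?I c\<close> chart_open(1)[OF V] continuous_on_open_vimage[of ?I c] by simp
    have "smooth_on {t \<in> ?I. c t \<in> V} l"
      unfolding l_def by (rule smooth_on_affine[OF bounded_linear_scaleR_left o])
    moreover have "l ` {t \<in> ?I. c t \<in> V} \<subseteq> \<phi> ` (U \<inter> V)"
    proof clarify
      fix t assume t: "t \<in> ?I" "c t \<in> V"
      then have "c t \<in> U \<inter> V" "\<phi> (c t) = l t" using l chart_inverse[OF U] by (auto simp: c_def)
      then show "l t \<in> \<phi> ` (U \<inter> V)" by (metis imageI)
    qed
    ultimately show ?thesis unfolding c_def
      by (intro smooth_on_compose[OF o[unfolded c_def] chart_open(3)[OF U chart_open(1)[OF V]]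
            transition_smooth[OF U V]]) (auto simp: c_def)
  qed
  ultimately have c: "smooth_curve ?I c" by (auto simp: smooth_curve_def)
  have c0: "c 0 = p" using chart_inverse(3)[OF U p] by (simp add: c_def l_def)
  have "(l has_vector_derivative w) (at 0)"
    unfolding l_def[abs_def] has_vector_derivative_def by (rule derivative_eq_intros refl | simp)+
  then have "((\<lambda>s. \<phi> (c s)) has_vector_derivative w) (at 0)"
    by (rule has_vector_derivative_transform_within_open[of _ _ _ ?I])
       (use \<open>0 < \<epsilon>\<close> l chart_inverse(2)[OF U] in \<open>auto simp: c_def\<close>)
  then have "velocity ?I c 0 = chart_vector U \<phi> p w"
    using velocity_eq_chart_vector[OF c _ _ U, of 0] \<open>0 < \<epsilon>\<close> c0 p vector_derivative_at by force
  then show ?thesis using c c0 \<open>0 < \<epsilon>\<close> unfolding tangent_space_def by (intro CollectI exI[of _ c] exI[of _ \<epsilon>]) simp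
qed

text \<open>This parametrisation by \<open>\<real>\<^sup>3\<close> shows that tangent spaces, defined as sets of velocities, are
  vector spaces of dimension at most three.\<close>

lemma tangent_space_chart:
  assumes U: "(U, \<phi>) \<in> atlas" and p: "p \<in> U"
  shows "tangent_space p = range (chart_vector U \<phi> p)"
proof
  show "tangent_space p \<subseteq> range (chart_vector U \<phi> p)"
    using velocity_eq_chart_vector[OF _ _ _ U] p by (fastforce simp: tangent_space_def)
qed (use chart_vector_in_tangent_space[OF assms] in auto)

lemma tangent_space_scale: "u \<in> tangent_space p \<Longrightarrow> (\<lambda>f. c * u f) \<in> tangent_space p"
proof -
  obtain U \<phi> where U: "(U, \<phi>) \<in> atlas" "p \<in> U" using atlas_covers by blast
  assume "u \<in> tangent_space p"
  then obtain w where "u = chart_vector U \<phi> p w" using tangent_space_chart[OF U] by auto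
  then have "(\<lambda>f. c * u f) = chart_vector U \<phi> p (c *\<^sub>R w)"
    using linear_cmul[OF chart_vector_linear[OF U]] by auto
  then show ?thesis using chart_vector_in_tangent_space[OF U] by simp
qed

lemma tangent_space_add:
  "u \<in> tangent_space p \<Longrightarrow> v \<in> tangent_space p \<Longrightarrow> (\<lambda>f. u f + v f) \<in> tangent_space p"
proof -
  obtain U \<phi> where U: "(U, \<phi>) \<in> atlas" "p \<in> U" using atlas_covers by blast
  assume "u \<in> tangent_space p" "v \<in> tangent_space p"
  then obtain w z where "u = chart_vector U \<phi> p w" "v = chart_vector U \<phi> p z"
    using tangent_space_chart[OF U] by auto
  then have "(\<lambda>f. u f + v f) = chart_vector U \<phi> p (w + z)"
    using linear_add[OF chart_vector_linear[OF U]] by auto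
  then show ?thesis using chart_vector_in_tangent_space[OF U] by simp
qed

lemma tangent_vector_not_smooth: "u \<in> tangent_space p \<Longrightarrow> \<not> smooth_fun f \<Longrightarrow> u f = 0"
  by (auto simp: tangent_space_def velocity_def)

lemma tangent_vector_const: "u \<in> tangent_space p \<Longrightarrow> u (\<lambda>_. c) = 0"
  by (auto simp: tangent_space_def velocity_def at_within_open[of 0 "{-\<epsilon><..<\<epsilon>}" for \<epsilon>])

section \<open>Smoothness of translations\<close>

lemma smooth_product_in_charts:
  fixes \<phi> \<psi> \<theta> :: "'g::lie_group_3 \<Rightarrow> real^3"
  assumes U: "(U, \<phi>) \<in> atlas" and V: "(V, \<psi>) \<in> atlas" and W: "(W, \<theta>) \<in> atlas"
  defines "R \<equiv> {z \<in> \<phi> ` U \<times> \<psi> ` V. inv_into U \<phi> (fst z) * inv_into V \<psi> (snd z) \<in> W}"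
  shows "open R" and "smooth_on R (\<lambda>z. \<theta> (inv_into U \<phi> (fst z) * inv_into V \<psi> (snd z)))"
proof -
  let ?P = "\<phi> ` U \<times> \<psi> ` V" and ?m = "\<lambda>z. inv_into U \<phi> (fst z) * inv_into V \<psi> (snd z)"
  have o: "open ?P" using chart_open(2) U V by (auto intro: open_Times)
  have cont: "continuous_on ?P ?m"
    by (intro continuous_on_mult' continuous_on_compose2[OF chart_inverse_continuous[OF U]]
        continuous_on_compose2[OF chart_inverse_continuous[OF V]] continuous_intros) auto
  have "R = ?m -` W \<inter> ?P" by (auto simp: R_def)
  then show "open R" using cont chart_open(1)[OF W] continuous_on_open_vimage[OF o, of ?m] by simp
  have "R = {(x, y). x \<in> \<phi> ` U \<and> y \<in> \<psi> ` V \<and> inv_into U \<phi> x * inv_into V \<psi> y \<in> W}"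
    by (auto simp: R_def)
  moreover have "(\<lambda>z. \<theta> (?m z)) = (\<lambda>(x, y). \<theta> (inv_into U \<phi> x * inv_into V \<psi> y))" by auto
  ultimately show "smooth_on R (\<lambda>z. \<theta> (?m z))" using mult_smooth[OF U V W] by (simp only:)
qed

text \<open>The value of \<open>f\<close> on products, in charts of both factors, is smooth jointly in both variables.
  Freezing one factor yields smoothness of \<open>f\<close> after a translation; differentiating in one of them
  describes the invariant vector fields.\<close>

lemma smooth_fun_product:
  fixes f :: "'g::lie_group_3 \<Rightarrow> real"
  assumes f: "smooth_fun f" and U: "(U, \<phi>) \<in> atlas" and V: "(V, \<psi>) \<in> atlas"
  shows "smooth_on (\<phi> ` U \<times> \<psi> ` V) (\<lambda>z. f (inv_into U \<phi> (fst z) * inv_into V \<psi> (snd z)))"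
proof (rule smooth_on_local)
  let ?P = "\<phi> ` U \<times> \<psi> ` V" and ?m = "\<lambda>z. inv_into U \<phi> (fst z) * inv_into V \<psi> (snd z)"
  show "open ?P" using chart_open(2) U V by (auto intro: open_Times)
  fix z assume z: "z \<in> ?P"
  obtain W \<theta> where W: "(W, \<theta>) \<in> atlas" "?m z \<in> W" using atlas_covers by blast
  define R where "R = {z \<in> ?P. ?m z \<in> W}"
  note R = smooth_product_in_charts[OF U V W(1), folded R_def]
  have "smooth_on R (\<lambda>z. f (inv_into W \<theta> (\<theta> (?m z))))"
    by (rule smooth_on_compose[OF R(1) chart_open(2)[OF W(1)] smooth_fun_chart[OF f W(1)] R(2)])
       (auto simp: R_def)
  then have "smooth_on R (\<lambda>z. f (?m z))"
    by (rule smooth_on_cong[OF R(1), rotated]) (simp add: R_def chart_inverse(3)[OF W(1)])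
  then show "\<exists>W. open W \<and> z \<in> W \<and> smooth_on W (\<lambda>z. f (?m z))" using R(1) z W by (auto simp: R_def)
qed

lemma smooth_fun_right_translation:
  fixes f :: "'g::lie_group_3 \<Rightarrow> real"
  assumes f: "smooth_fun f"
  shows "smooth_fun (\<lambda>x. f (x * a))"
  unfolding smooth_fun_def
proof clarify
  fix U :: "'g set" and \<phi> :: "'g \<Rightarrow> real^3" assume U: "(U, \<phi>) \<in> atlas"
  obtain V \<psi> where V: "(V, \<psi>) \<in> atlas" "a \<in> V" using atlas_covers by blast
  have l: "bounded_linear (\<lambda>x::real^3. (x, 0::real^3))"
    by (intro bounded_linear_Pair bounded_linear_ident bounded_linear_zero)
  have "smooth_on (\<phi> ` U) (\<lambda>x. (0, \<psi> a) + (x, 0::real^3))"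
    by (rule smooth_on_affine[OF l chart_open(2)[OF U]])
  then have "smooth_on (\<phi> ` U) (\<lambda>x. (x, \<psi> a))" by simp
  then have "smooth_on (\<phi> ` U) (\<lambda>x. f (inv_into U \<phi> (fst (x, \<psi> a)) * inv_into V \<psi> (snd (x, \<psi> a))))"
    by (rule smooth_on_compose[OF chart_open(2)[OF U]
          open_Times[OF chart_open(2)[OF U] chart_open(2)[OF V(1)]] smooth_fun_product[OF f U V(1)]])
       (use V in auto)
  then show "smooth_on (\<phi> ` U) (\<lambda>x. f (inv_into U \<phi> x * a))"
    using chart_inverse(3)[OF V] by simp
qed

lemma smooth_fun_left_translation:
  fixes f :: "'g::lie_group_3 \<Rightarrow> real"
  assumes f: "smooth_fun f"
  shows "smooth_fun (\<lambda>x. f (a * x))"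
  unfolding smooth_fun_def
proof clarify
  fix U :: "'g set" and \<phi> :: "'g \<Rightarrow> real^3" assume U: "(U, \<phi>) \<in> atlas"
  obtain V \<psi> where V: "(V, \<psi>) \<in> atlas" "a \<in> V" using atlas_covers by blast
  have l: "bounded_linear (\<lambda>x::real^3. (0::real^3, x))"
    by (intro bounded_linear_Pair bounded_linear_ident bounded_linear_zero)
  have "smooth_on (\<phi> ` U) (\<lambda>x. (\<psi> a, 0) + (0::real^3, x))"
    by (rule smooth_on_affine[OF l chart_open(2)[OF U]])
  then have "smooth_on (\<phi> ` U) (\<lambda>x. (\<psi> a, x))" by simp
  then have "smooth_on (\<phi> ` U) (\<lambda>x. f (inv_into V \<psi> (fst (\<psi> a, x)) * inv_into U \<phi> (snd (\<psi> a, x))))"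
    by (rule smooth_on_compose[OF chart_open(2)[OF U]
          open_Times[OF chart_open(2)[OF V(1)] chart_open(2)[OF U]] smooth_fun_product[OF f V(1) U]])
       (use V in auto)
  then show "smooth_on (\<phi> ` U) (\<lambda>x. f (a * inv_into U \<phi> x))"
    using chart_inverse(3)[OF V] by simp
qed

section \<open>Left- and right-invariant vector fields\<close>

lemma frechet_derivative_partial:
  assumes "(F has_derivative D) (at (x, y))"
  shows "frechet_derivative (\<lambda>x. F (x, y)) (at x) w = D (w, 0)"
    and "frechet_derivative (\<lambda>y. F (x, y)) (at y) w' = D (0, w')"
proof -
  have "((\<lambda>x. (x, y)) has_derivative (\<lambda>h. (h, 0))) (at x)"
    "((\<lambda>y. (x, y)) has_derivative (\<lambda>h. (0, h))) (at y)"
    by (auto intro!: derivative_eq_intros)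
  from this[THEN has_derivative_compose] assms
  have "((\<lambda>x. F (x, y)) has_derivative (\<lambda>h. D (h, 0))) (at x)"
    "((\<lambda>y. F (x, y)) has_derivative (\<lambda>h. D (0, h))) (at y)"
    by blast+
  from this[THEN frechet_derivative_at]
  show "frechet_derivative (\<lambda>x. F (x, y)) (at x) w = D (w, 0)"
    "frechet_derivative (\<lambda>y. F (x, y)) (at y) w' = D (0, w')"
    by metis+
qed

lemma vector_field_at: "vector_field Y \<Longrightarrow> Y p \<in> tangent_space p"
  and vector_field_smooth: "vector_field Y \<Longrightarrow> smooth_fun f \<Longrightarrow> smooth_fun (\<lambda>p. Y p f)"
  by (auto simp: vector_field_def)

lemma vector_field_add: "vector_field Y \<Longrightarrow> vector_field Z \<Longrightarrow> vector_field (vf_add Y Z)"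
  by (simp add: vector_field_def vf_add_def tangent_space_add smooth_fun_add)

lemma vector_field_mult: "smooth_fun h \<Longrightarrow> vector_field Y \<Longrightarrow> vector_field (vf_mult h Y)"
  by (simp add: vector_field_def vf_mult_def tangent_space_scale smooth_fun_mult)

lemma lie_algebra_vector_field: "Y \<in> lie_algebra \<Longrightarrow> vector_field Y"
  by (simp add: lie_algebra_def)

lemma left_invariant_at:
  assumes "Y \<in> lie_algebra"
  shows "Y p = pushforward (\<lambda>x. p * x) (Y 1)"
proof -
  have "Y (p * 1) = pushforward (\<lambda>x. p * x) (Y 1)" using assms unfolding lie_algebra_def by blast
  then show ?thesis by simp
qed

text \<open>A left-invariant field is determined by its value at any one point, since left translation
  carries that point to every other.\<close>

lemma left_invariant_eqI:
  assumes "Y \<in> lie_algebra" "Z \<in> lie_algebra" "Y p = Z p"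
  shows "Y = Z"
proof
  fix q
  have "A q = pushforward (\<lambda>x. q * ginv p * x) (A p)" if "A \<in> lie_algebra" for A :: "'a vfield"
  proof -
    have "A ((q * ginv p) * p) = pushforward (\<lambda>x. q * ginv p * x) (A p)"
      using that unfolding lie_algebra_def by blast
    then show ?thesis by (simp add: mult.assoc ginv_left)
  qed
  then show "Y q = Z q" using assms by metis
qed

text \<open>The right-invariant vector field with value \<open>v\<close> at \<open>1\<close>.\<close>

definition right_field :: "'g::lie_group_3 tvec \<Rightarrow> 'g vfield" where
  "right_field v = (\<lambda>p. pushforward (\<lambda>x. x * p) v)"

lemma right_field_one [simp]: "right_field v 1 = v"
  by (simp add: right_field_def pushforward_def)

text \<open>At \<open>p\<close>, the right-invariant field differentiates \<open>f (x * p)\<close> in \<open>x\<close> at \<open>1\<close>: it is a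
  partial derivative of \<open>f (x * y)\<close> in the first factor.\<close>

lemma right_field_in_chart:
  assumes U: "(U, \<phi>) \<in> atlas" "1 \<in> U" and V: "(V, \<psi>) \<in> atlas" "y \<in> \<psi> ` V" and f: "smooth_fun f"
  defines "F \<equiv> \<lambda>z. f (inv_into U \<phi> (fst z) * inv_into V \<psi> (snd z))"
  shows "right_field (chart_vector U \<phi> 1 w) (inv_into V \<psi> y) f
       = frechet_derivative F (at (\<phi> 1, y)) (w, 0)"
proof -
  have "(F has_derivative frechet_derivative F (at (\<phi> 1, y))) (at (\<phi> 1, y))"
    unfolding F_def
    by (rule smooth_on_has_derivative[OF _ smooth_fun_product[OF f U(1) V(1)]])
       (use U V chart_open(2) in \<open>auto intro: open_Times\<close>)
  from frechet_derivative_partial(1)[OF this, of w] show ?thesis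
    by (simp add: right_field_def pushforward_def chart_vector_def smooth_fun_right_translation f F_def)
qed

lemma left_field_in_chart:
  assumes U: "(U, \<phi>) \<in> atlas" "x \<in> \<phi> ` U" and V: "(V, \<psi>) \<in> atlas" "1 \<in> V" and f: "smooth_fun f"
    and Y: "Y \<in> lie_algebra" "Y 1 = chart_vector V \<psi> 1 w"
  defines "F \<equiv> \<lambda>z. f (inv_into U \<phi> (fst z) * inv_into V \<psi> (snd z))"
  shows "Y (inv_into U \<phi> x) f = frechet_derivative F (at (x, \<psi> 1)) (0, w)"
proof -
  have "(F has_derivative frechet_derivative F (at (x, \<psi> 1))) (at (x, \<psi> 1))"
    unfolding F_def
    by (rule smooth_on_has_derivative[OF _ smooth_fun_product[OF f U(1) V(1)]])
       (use U V chart_open(2) in \<open>auto intro: open_Times\<close>)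
  from frechet_derivative_partial(2)[OF this, of w] show ?thesis
    by (subst left_invariant_at[OF Y(1)])
       (simp add: Y(2) pushforward_def chart_vector_def smooth_fun_left_translation f F_def)
qed

lemma right_field_vector_field:
  fixes v :: "'g::lie_group_3 tvec"
  assumes v: "v \<in> tangent_space 1"
  shows "vector_field (right_field v)"
  unfolding vector_field_def
proof (intro conjI allI impI)
  obtain U :: "'g set" and \<phi> where U: "(U, \<phi>) \<in> atlas" "1 \<in> U" using atlas_covers by blast
  obtain w where w: "v = chart_vector U \<phi> 1 w" using v tangent_space_chart[OF U] by auto
  {
    fix f :: "'g \<Rightarrow> real" assume f: "smooth_fun f"
    show "smooth_fun (\<lambda>p. right_field v p f)"
      unfolding smooth_fun_def
    proof clarify
      fix V :: "'g set" and \<psi> :: "'g \<Rightarrow> real^3" assume V: "(V, \<psi>) \<in> atlas"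
      let ?F = "\<lambda>z. f (inv_into U \<phi> (fst z) * inv_into V \<psi> (snd z))"
      have o: "open (\<phi> ` U \<times> \<psi> ` V)" using U V chart_open(2) by (auto intro: open_Times)
      have l: "bounded_linear (\<lambda>x::real^3. (0::real^3, x))"
        by (intro bounded_linear_Pair bounded_linear_ident bounded_linear_zero)
      have "smooth_on (\<psi> ` V) (\<lambda>y. (\<phi> 1, 0) + (0::real^3, y))"
        by (rule smooth_on_affine[OF l chart_open(2)[OF V]])
      then have "smooth_on (\<psi> ` V) (\<lambda>y. (\<phi> 1, y))" by simp
      then have "smooth_on (\<psi> ` V) (\<lambda>y. frechet_derivative ?F (at (\<phi> 1, y)) (w, 0))"
        by (rule smooth_on_compose[OF chart_open(2)[OF V] o
              smooth_on_directional_derivative[OF o smooth_fun_product[OF f U(1) V], where v = "(w, 0)"]])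
           (use U in auto)
      then show "smooth_on (\<psi> ` V) (\<lambda>y. right_field v (inv_into V \<psi> y) f)"
        by (rule smooth_on_cong[OF chart_open(2)[OF V], rotated])
           (simp add: w right_field_in_chart[OF U V _ f])
    qed
  }
  fix p
  obtain V :: "'g set" and \<psi> where V: "(V, \<psi>) \<in> atlas" "p \<in> V" using atlas_covers by blast
  let ?M = "\<lambda>z. \<psi> (inv_into U \<phi> (fst z) * inv_into V \<psi> (snd z))"
  define R where "R = {z \<in> \<phi> ` U \<times> \<psi> ` V. inv_into U \<phi> (fst z) * inv_into V \<psi> (snd z) \<in> V}"
  note R = smooth_product_in_charts[OF U(1) V(1) V(1), folded R_def]
  have inR: "(\<phi> 1, \<psi> p) \<in> R" using U V chart_inverse(3)[OF U] chart_inverse(3)[OF V] by (simp add: R_def)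
  define D where "D = frechet_derivative ?M (at (\<phi> 1, \<psi> p))"
  have D: "(?M has_derivative D) (at (\<phi> 1, \<psi> p))"
    unfolding D_def by (rule smooth_on_has_derivative[OF R inR])
  have M1: "?M (\<phi> 1, \<psi> p) = \<psi> p" using chart_inverse(3)[OF U] chart_inverse(3)[OF V] by simp
  have "right_field v p = chart_vector V \<psi> p (D (w, 0))"
  proof
    fix f :: "'g \<Rightarrow> real"
    show "right_field v p f = chart_vector V \<psi> p (D (w, 0)) f"
    proof (cases "smooth_fun f")
      case True
      let ?F = "\<lambda>z. f (inv_into U \<phi> (fst z) * inv_into V \<psi> (snd z))"
      have "((\<lambda>z. f (inv_into V \<psi> (?M z))) has_derivative (\<lambda>h. chart_vector V \<psi> p (D h) f)) (at (\<phi> 1, \<psi> p))"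
        by (rule has_derivative_compose[OF D]) (use chart_derivative[OF V True] M1 in simp)
      then have "(?F has_derivative (\<lambda>h. chart_vector V \<psi> p (D h) f)) (at (\<phi> 1, \<psi> p))"
        by (rule has_derivative_transform_within_open[OF _ R(1) inR])
           (simp add: R_def chart_inverse(3)[OF V(1)])
      from frechet_derivative_at[OF this] right_field_in_chart[OF U V(1) _ True, of "\<psi> p" w]
      show ?thesis using V w chart_inverse(3)[OF V] by (metis imageI)
    next
      case False
      \<comment> \<open>Right translation by \<open>p\<close> is invertible, so it cannot make \<open>f\<close> smooth, and both sides take the default value.\<close>
      have "\<not> smooth_fun (\<lambda>x. f (x * p))"
      proof
        assume "smooth_fun (\<lambda>x. f (x * p))"
        then have "smooth_fun (\<lambda>x. f (x * ginv p * p))" by (rule smooth_fun_right_translation)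
        then show False using False by (simp add: mult.assoc ginv_left)
      qed
      then show ?thesis using False tangent_vector_not_smooth[OF v]
        by (simp add: right_field_def pushforward_def chart_vector_def)
    qed
  qed
  then show "right_field v p \<in> tangent_space p" using chart_vector_in_tangent_space[OF V] by simp
qed

text \<open>Left- and right-invariant fields commute: the two iterated derivatives of \<open>f\<close> at \<open>1\<close> are the
  mixed partial derivatives of \<open>f (x * y)\<close> at \<open>(1, 1)\<close>, taken in either order.\<close>

lemma lie_bracket_right_field:
  fixes v :: "'g::lie_group_3 tvec"
  assumes Y: "Y \<in> lie_algebra" and v: "v \<in> tangent_space 1"
  shows "lie_bracket Y (right_field v) 1 = (\<lambda>f. 0)"
proof
  fix f :: "'g \<Rightarrow> real"
  obtain U :: "'g set" and \<phi> where U: "(U, \<phi>) \<in> atlas" "1 \<in> U" using atlas_covers by blast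
  obtain w where w: "v = chart_vector U \<phi> 1 w" using v tangent_space_chart[OF U] by auto
  have Y1: "Y 1 \<in> tangent_space 1" using vector_field_at lie_algebra_vector_field Y by blast
  then obtain u where u: "Y 1 = chart_vector U \<phi> 1 u" using tangent_space_chart[OF U] by auto
  show "lie_bracket Y (right_field v) 1 f = 0"
  proof (cases "smooth_fun f")
    case f: True
    let ?F = "\<lambda>z. f (inv_into U \<phi> (fst z) * inv_into U \<phi> (snd z))"
    let ?P = "\<phi> ` U \<times> \<phi> ` U" and ?o = "(\<phi> 1, \<phi> 1)"
    let ?D = "\<lambda>h z. frechet_derivative ?F (at z) h"
    have o: "open ?P" "?o \<in> ?P" using U chart_open(2) by (auto intro: open_Times)
    have F: "smooth_on ?P ?F" by (rule smooth_fun_product[OF f U(1) U(1)])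
    have DD: "(?D h has_derivative frechet_derivative (?D h) (at ?o)) (at ?o)" for h
      by (rule smooth_on_has_derivative[OF o(1) smooth_on_directional_derivative[OF o(1) F] o(2)])
    have chart_differentiable: "(\<lambda>y. g (inv_into U \<phi> y)) differentiable (at (\<phi> 1))"
      if "smooth_fun g" for g :: "'g \<Rightarrow> real"
      using chart_derivative[OF U that] differentiable_def by blast
    have "Y 1 (\<lambda>q. right_field v q f) = frechet_derivative (\<lambda>y. right_field v (inv_into U \<phi> y) f) (at (\<phi> 1)) u"
      using vector_field_smooth[OF right_field_vector_field[OF v] f] by (simp add: u chart_vector_def)
    also have "\<dots> = frechet_derivative (\<lambda>y. ?D (w, 0) (\<phi> 1, y)) (at (\<phi> 1)) u"
      using chart_differentiable[OF vector_field_smooth[OF right_field_vector_field[OF v] f]]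
      by (subst frechet_derivative_transform_within_open[OF _ chart_open(2)[OF U(1)],
            where g = "\<lambda>y. ?D (w, 0) (\<phi> 1, y)"])
         (use U(2) in \<open>simp_all add: w right_field_in_chart[OF U U(1) _ f]\<close>)
    also have "\<dots> = frechet_derivative (?D (w, 0)) (at ?o) (0, u)"
      by (rule frechet_derivative_partial(2)[OF DD])
    also have "\<dots> = frechet_derivative (?D (0, u)) (at ?o) (w, 0)"
      using symmetric_second_derivative[OF _ o] F smooth_on_open_iff[OF o(1)] by blast
    also have "\<dots> = frechet_derivative (\<lambda>x. ?D (0, u) (x, \<phi> 1)) (at (\<phi> 1)) w"
      by (rule frechet_derivative_partial(1)[OF DD, symmetric])
    also have "\<dots> = frechet_derivative (\<lambda>x. Y (inv_into U \<phi> x) f) (at (\<phi> 1)) w"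
      using chart_differentiable[OF vector_field_smooth[OF lie_algebra_vector_field[OF Y] f]]
      by (subst frechet_derivative_transform_within_open[OF _ chart_open(2)[OF U(1)],
            where f = "\<lambda>x. Y (inv_into U \<phi> x) f" and g = "\<lambda>x. ?D (0, u) (x, \<phi> 1)"])
         (use U(2) in \<open>simp_all add: left_field_in_chart[OF U(1) _ U f Y u]\<close>)
    also have "\<dots> = v (\<lambda>q. Y q f)"
      using vector_field_smooth[OF lie_algebra_vector_field[OF Y] f] by (simp add: w chart_vector_def)
    finally show ?thesis by (simp add: lie_bracket_def)
  next
    case False
    then have "right_field v q f = 0" "Y q f = 0" for q
      using tangent_vector_not_smooth vector_field_at right_field_vector_field[OF v]
        lie_algebra_vector_field[OF Y] by blast+
    then show ?thesis using tangent_vector_const[OF v] tangent_vector_const[OF Y1] by (simp add: lie_bracket_def)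
  qed
qed

section \<open>The Levi-Civita connection of a bi-invariant metric\<close>

locale bi_invariant_lie_group =
  fixes m :: "'g::lie_group_3 metric" and nabla :: "'g connection" and X :: "3 \<Rightarrow> 'g vfield"
  assumes metric: "riemannian_metric m" and invariant: "bi_invariant m"
    and connection: "levi_civita m nabla" and basis: "orthonormal_basis m X"
begin

lemma metric_sym: "u \<in> tangent_space p \<Longrightarrow> v \<in> tangent_space p \<Longrightarrow> m p u v = m p v u"
  and metric_scale: "u \<in> tangent_space p \<Longrightarrow> v \<in> tangent_space p \<Longrightarrow> m p (\<lambda>f. c * u f) v = c * m p u v"
  and metric_add: "u \<in> tangent_space p \<Longrightarrow> v \<in> tangent_space p \<Longrightarrow> w \<in> tangent_space p \<Longrightarrow>
    m p (\<lambda>f. u f + w f) v = m p u v + m p w v"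
  and metric_smooth: "vector_field Y \<Longrightarrow> vector_field Z \<Longrightarrow> smooth_fun (\<lambda>p. m p (Y p) (Z p))"
  using metric unfolding riemannian_metric_def by blast+

lemma metric_comb:
  "(\<And>i::3. u i \<in> tangent_space p) \<Longrightarrow> v \<in> tangent_space p \<Longrightarrow>
    m p (\<lambda>f. \<Sum>i\<in>UNIV. c i * u i f) v = (\<Sum>i\<in>UNIV. c i * m p (u i) v)"
  by (simp add: sum_3 tangent_space_add tangent_space_scale metric_add metric_scale)

lemma basis_left_invariant: "X i \<in> lie_algebra" and basis_vector_field: "vector_field (X i)"
  using basis lie_algebra_vector_field by (auto simp: orthonormal_basis_def)

lemma basis_tangent: "X i p \<in> tangent_space p"
  using basis_vector_field vector_field_at by blast

lemma left_invariant_inner: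
  assumes "Y \<in> lie_algebra" "Z \<in> lie_algebra"
  shows "m p (Y p) (Z p) = m 1 (Y 1) (Z 1)"
proof -
  have "Y 1 \<in> tangent_space 1" "Z 1 \<in> tangent_space 1"
    using assms lie_algebra_vector_field vector_field_at by blast+
  then have "m (p * 1) (pushforward (\<lambda>x. p * x) (Y 1)) (pushforward (\<lambda>x. p * x) (Z 1)) = m 1 (Y 1) (Z 1)"
    using invariant unfolding bi_invariant_def by blast
  then show ?thesis using left_invariant_at assms by (metis mult.right_neutral)
qed

lemma right_field_inner:
  assumes "v \<in> tangent_space 1" "w \<in> tangent_space 1"
  shows "m p (right_field v p) (right_field w p) = m 1 v w"
proof -
  have "m (1 * p) (pushforward (\<lambda>x. x * p) v) (pushforward (\<lambda>x. x * p) w) = m 1 v w"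
    using assms invariant unfolding bi_invariant_def by blast
  then show ?thesis by (simp add: right_field_def)
qed

lemma basis_orthonormal: "m p (X i p) (X j p) = (if i = j then 1 else 0)"
  using basis left_invariant_inner[OF basis_left_invariant basis_left_invariant] by (simp add: orthonormal_basis_def lie_inner_def)

text \<open>The fields \<open>X\<close> stay orthonormal at every point by left invariance, so their components in a
  chart are three independent vectors of \<open>\<real>\<^sup>3\<close> and span it.\<close>

lemma tangent_expansion:
  assumes v: "v \<in> tangent_space p"
  shows "v = (\<lambda>f. \<Sum>i\<in>UNIV. m p v (X i p) * X i p f)"
proof -
  obtain U :: "'g set" and \<phi> where U: "(U, \<phi>) \<in> atlas" "p \<in> U" using atlas_covers by blast
  have "\<exists>w. X i p = chart_vector U \<phi> p w" for i using basis_tangent tangent_space_chart[OF U] by auto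
  then obtain W where W: "\<And>i. X i p = chart_vector U \<phi> p (W i)" by metis
  \<comment> \<open>The coefficients can be recovered by the metric, so \<open>L\<close> is injective and therefore surjective.\<close>
  define L :: "real^3 \<Rightarrow> real^3" where "L c = (\<Sum>i\<in>UNIV. c $ i *\<^sub>R W i)" for c
  have L: "chart_vector U \<phi> p (L c) = (\<lambda>f. \<Sum>i\<in>UNIV. c $ i * X i p f)" for c
    by (rule ext) (simp add: L_def W linear_sum[OF chart_vector_linear[OF U]]
        linear_cmul[OF chart_vector_linear[OF U]])
  have coeff: "m p (chart_vector U \<phi> p (L c)) (X j p) = c $ j" for c j
    unfolding L by (simp add: metric_comb[OF basis_tangent basis_tangent] basis_orthonormal if_distrib cong: if_cong)
  have "linear L" unfolding L_def
    by (intro linearI) (simp_all add: scaleR_add_left sum.distrib scaleR_right.sum)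
  moreover have "inj L"
    by (rule injI) (metis coeff vec_eq_iff)
  ultimately have "surj L" by (rule linear_injective_imp_surjective) simp
  moreover obtain w where "v = chart_vector U \<phi> p w" using v tangent_space_chart[OF U] by auto
  ultimately obtain c where c: "v = chart_vector U \<phi> p (L c)" by (metis surjD)
  show ?thesis using L[of c] coeff[of c] unfolding c by simp
qed

lemma nabla_vector_field: "vector_field Y \<Longrightarrow> vector_field Z \<Longrightarrow> vector_field (nabla Y Z)"
  using connection by (simp add: levi_civita_def affine_connection_def)

lemma nabla_add:
  "vector_field Y \<Longrightarrow> vector_field A \<Longrightarrow> vector_field Z \<Longrightarrow>
    nabla (vf_add Y A) Z = vf_add (nabla Y Z) (nabla A Z)"
  using connection by (simp add: levi_civita_def affine_connection_def)

lemma nabla_mult: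
  "vector_field Y \<Longrightarrow> vector_field Z \<Longrightarrow> smooth_fun h \<Longrightarrow> nabla (vf_mult h Y) Z = vf_mult h (nabla Y Z)"
  using connection by (simp add: levi_civita_def affine_connection_def)

lemma nabla_torsion_free:
  "vector_field Y \<Longrightarrow> vector_field Z \<Longrightarrow> vf_diff (nabla Y Z) (nabla Z Y) = lie_bracket Y Z"
  using connection by (simp add: levi_civita_def)

lemma nabla_metric:
  "vector_field Y \<Longrightarrow> vector_field Z \<Longrightarrow> vector_field A \<Longrightarrow>
    Y p (\<lambda>q. m q (Z q) (A q)) = m p (nabla Y Z p) (A p) + m p (Z p) (nabla Y A p)"
  using connection by (simp add: levi_civita_def)

text \<open>Expanding \<open>Y\<close> in the basis fields, with smooth coefficients, and using linearity of the connection
  over smooth functions shows that \<open>\<nabla>\<^sub>Y Z\<close> at \<open>p\<close> depends on \<open>Y\<close> only through its value at \<open>p\<close>.\<close>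

lemma nabla_expansion:
  assumes Y: "vector_field Y" and Z: "vector_field Z"
  shows "nabla Y Z p = (\<lambda>f. \<Sum>i\<in>UNIV. m p (Y p) (X i p) * nabla (X i) Z p f)"
proof -
  let ?h = "\<lambda>i q. m q (Y q) (X i q)"
  have h: "smooth_fun (?h i)" for i using metric_smooth[OF Y basis_vector_field] .
  have "Y = (\<lambda>q f. \<Sum>i\<in>UNIV. ?h i q * X i q f)"
    using tangent_expansion[OF vector_field_at[OF Y]] by (intro ext) metis
  then have eq: "Y = vf_add (vf_add (vf_mult (?h 1) (X 1)) (vf_mult (?h 2) (X 2))) (vf_mult (?h 3) (X 3))"
    by (simp add: sum_3 vf_add_def vf_mult_def)
  have "nabla Y Z = vf_add (vf_add (vf_mult (?h 1) (nabla (X 1) Z)) (vf_mult (?h 2) (nabla (X 2) Z)))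
      (vf_mult (?h 3) (nabla (X 3) Z))"
    by (subst eq) (simp add: nabla_add nabla_mult vector_field_add vector_field_mult h basis_vector_field Z)
  then show ?thesis by (simp add: vf_add_def vf_mult_def sum_3)
qed

lemma nabla_tensorial:
  "vector_field Y \<Longrightarrow> vector_field Y' \<Longrightarrow> vector_field Z \<Longrightarrow> Y p = Y' p \<Longrightarrow> nabla Y Z p = nabla Y' Z p"
  by (simp add: nabla_expansion)

text \<open>The commutator vanishes at \<open>1\<close>, so the torsion-free connection lets the two fields be exchanged;
  then the right-invariant field may be replaced by \<open>Z\<close>, which has the same value at \<open>1\<close>.\<close>

lemma nabla_right_field:
  assumes Y: "Y \<in> lie_algebra" and Z: "Z \<in> lie_algebra"
  shows "nabla Y (right_field (Z 1)) 1 = nabla Z Y 1"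
proof -
  note vf = lie_algebra_vector_field[OF Y] lie_algebra_vector_field[OF Z]
  have Z1: "Z 1 \<in> tangent_space 1" using vf vector_field_at by blast
  note R = right_field_vector_field[OF Z1]
  have "vf_diff (nabla Y (right_field (Z 1))) (nabla (right_field (Z 1)) Y) 1 = (\<lambda>f. 0)"
    using nabla_torsion_free[OF vf(1) R] lie_bracket_right_field[OF Y Z1] by metis
  then have "nabla Y (right_field (Z 1)) 1 = nabla (right_field (Z 1)) Y 1"
    by (auto simp: vf_diff_def fun_eq_iff)
  also have "\<dots> = nabla Z Y 1" by (rule nabla_tensorial[OF R vf(2,1)]) simp
  finally show ?thesis .
qed

definition connection_form :: "'g vfield \<Rightarrow> 'g vfield \<Rightarrow> 'g vfield \<Rightarrow> real" where
  "connection_form A B C = lie_inner m (nabla A B) C"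

text \<open>The function \<open>\<langle>B, C\<rangle>\<close> is constant, and so is \<open>\<langle>A', C'\<rangle>\<close> for the right-invariant fields \<open>A'\<close> and
  \<open>C'\<close> that agree with \<open>A\<close> and \<open>C\<close> at \<open>1\<close>. Differentiating the first along \<open>A\<close> and the second
  along \<open>B\<close> gives the two identities.\<close>

lemma connection_form_skew:
  assumes A: "A \<in> lie_algebra" and B: "B \<in> lie_algebra" and C: "C \<in> lie_algebra"
  shows "connection_form A C B = - connection_form A B C"
    and "connection_form C B A = - connection_form A B C"
proof -
  note vf = lie_algebra_vector_field[OF A] lie_algebra_vector_field[OF B] lie_algebra_vector_field[OF C]
  have t: "Y 1 \<in> tangent_space 1" if "vector_field Y" for Y :: "'g vfield" using that vector_field_at by blast
  have "0 = A 1 (\<lambda>q. m q (B q) (C q))"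
    by (subst left_invariant_inner[OF B C]) (simp add: tangent_vector_const[OF t[OF vf(1)]])
  also have "\<dots> = m 1 (nabla A B 1) (C 1) + m 1 (B 1) (nabla A C 1)"
    using nabla_metric vf by blast
  finally show "connection_form A C B = - connection_form A B C"
    using metric_sym[OF t t, OF vf(2) nabla_vector_field[OF vf(1,3)]] by (simp add: connection_form_def lie_inner_def)
  let ?A = "right_field (A 1)" and ?C = "right_field (C 1)"
  have R: "vector_field ?A" "vector_field ?C" using right_field_vector_field t vf by blast+
  have "0 = B 1 (\<lambda>q. m q (?A q) (?C q))"
    by (subst right_field_inner[OF t[OF vf(1)] t[OF vf(3)]]) (simp add: tangent_vector_const[OF t[OF vf(2)]])
  also have "\<dots> = m 1 (nabla B ?A 1) (?C 1) + m 1 (?A 1) (nabla B ?C 1)"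
    using nabla_metric vf R by blast
  also have "\<dots> = m 1 (nabla A B 1) (C 1) + m 1 (A 1) (nabla C B 1)"
    by (simp add: nabla_right_field A B C)
  finally show "connection_form C B A = - connection_form A B C"
    using metric_sym[OF t t, OF vf(1) nabla_vector_field[OF vf(3,2)]] by (simp add: connection_form_def lie_inner_def)
qed

lemma connection_form_repeated:
  assumes "A \<in> lie_algebra" "B \<in> lie_algebra"
  shows "connection_form B A A = 0" "connection_form A B A = 0" "connection_form A A B = 0"
proof -
  show *: "connection_form B A A = 0" "connection_form A B A = 0"
    using connection_form_skew(1)[of B A A] connection_form_skew(2)[of A B A] assms by simp_all
  show "connection_form A A B = 0" using connection_form_skew(1)[of A B A] * assms by simp
qed

text \<open>The bracket is \<open>\<nabla>\<^sub>T N - \<nabla>\<^sub>N T\<close>, and by antisymmetry the two terms contribute equally, which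
  cancels the factor \<open>1/2\<close> in the definition of the Lie group torsion.\<close>

lemma lie_torsion_connection_form:
  assumes "T t \<in> lie_algebra" "N t \<in> lie_algebra" "B t \<in> lie_algebra"
  shows "lie_torsion m T N B t = connection_form (T t) (N t) (B t)"
proof -
  note vf = assms[THEN lie_algebra_vector_field]
  have t: "Y 1 \<in> tangent_space 1" if "vector_field Y" for Y :: "'g vfield" using that vector_field_at by blast
  have "lie_bracket (T t) (N t) 1 = (\<lambda>f. nabla (T t) (N t) 1 f + (-1) * nabla (N t) (T t) 1 f)"
    by (simp add: nabla_torsion_free[OF vf(1,2), symmetric] vf_diff_def)
  then have "lie_inner m (lie_bracket (T t) (N t)) (B t) = connection_form (T t) (N t) (B t) - connection_form (N t) (T t) (B t)"
    using metric_add[OF t t tangent_space_scale[OF t], of "nabla (T t) (N t)" "B t" "nabla (N t) (T t)" "-1"]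
      metric_scale[OF t t, of "nabla (N t) (T t)" "B t" "-1"] nabla_vector_field vf
    by (simp add: lie_inner_def connection_form_def)
  moreover have "connection_form (N t) (T t) (B t) = - connection_form (T t) (N t) (B t)"
    using connection_form_skew(2)[OF assms(3,1,2)] connection_form_skew(1)[OF assms(3,2,1)] connection_form_skew(2)[OF assms]
    by linarith
  ultimately show ?thesis by (simp add: lie_torsion_def)
qed

lemma lie_inner_coords:
  assumes "vector_field Y" "vector_field Z"
  shows "lie_inner m Y Z = coords m X Y \<bullet> coords m X Z"
proof -
  have t: "Y 1 \<in> tangent_space 1" "Z 1 \<in> tangent_space 1" using assms vector_field_at by blast+
  have "lie_inner m Y Z = (\<Sum>i\<in>UNIV. m 1 (Y 1) (X i 1) * m 1 (X i 1) (Z 1))"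
    unfolding lie_inner_def
    by (subst tangent_expansion[OF t(1)]) (rule metric_comb[OF basis_tangent t(2)])
  also have "\<dots> = (\<Sum>i\<in>UNIV. m 1 (Y 1) (X i 1) * m 1 (Z 1) (X i 1))"
    using metric_sym[OF basis_tangent t(2)] by simp
  finally show ?thesis by (simp add: coords_def inner_vec_def lie_inner_def)
qed

lemma coords_linear_comb: "coords m X (linear_comb X u) = u"
proof -
  have "m 1 (\<lambda>f. \<Sum>i\<in>UNIV. u $ i * X i 1 f) (X j 1) = u $ j" for j
    by (simp add: metric_comb[OF basis_tangent basis_tangent] basis_orthonormal if_distrib cong: if_cong)
  then show ?thesis by (simp add: coords_def lie_inner_def linear_comb_def vec_eq_iff)
qed

lemma linear_comb_vector_field: "vector_field (linear_comb X u)"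
proof -
  have "linear_comb X u = vf_add (vf_add (vf_mult (\<lambda>_. u $ 1) (X 1)) (vf_mult (\<lambda>_. u $ 2) (X 2))) (vf_mult (\<lambda>_. u $ 3) (X 3))"
    by (simp add: linear_comb_def sum_3 vf_add_def vf_mult_def)
  then show ?thesis by (simp add: vector_field_add vector_field_mult smooth_fun_const basis_vector_field)
qed

lemma coords_add:
  "vector_field Y \<Longrightarrow> vector_field Z \<Longrightarrow> coords m X (vf_add Y Z) = coords m X Y + coords m X Z"
  using metric_add[OF vector_field_at basis_tangent vector_field_at]
  by (simp add: coords_def lie_inner_def vf_add_def vec_eq_iff)

lemma coords_scale: "vector_field Y \<Longrightarrow> coords m X (vf_scale c Y) = c *\<^sub>R coords m X Y"
  using metric_scale[OF vector_field_at basis_tangent]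
  by (simp add: coords_def lie_inner_def vf_scale_def vf_mult_def vec_eq_iff)

lemma vector_field_scale: "vector_field Y \<Longrightarrow> vector_field (vf_scale c Y)"
  by (simp add: vf_scale_def vector_field_mult smooth_fun_const)

end

section \<open>Frenet curves in coordinates\<close>

context bi_invariant_lie_group
begin

lemma frame_coords:
  assumes f: "positive_frame m X T N B" and lie: "T \<in> lie_algebra" "N \<in> lie_algebra" "B \<in> lie_algebra"
    and Y: "vector_field Y"
    and "lie_inner m Y T = 0" "lie_inner m Y N = \<nu>" "lie_inner m Y B = \<beta>"
  shows "coords m X Y = \<nu> *\<^sub>R coords m X N + \<beta> *\<^sub>R coords m X B"
proof -
  note vf = lie[THEN lie_algebra_vector_field]
  note c = lie_inner_coords[OF vf(1) vf(1)] lie_inner_coords[OF vf(2) vf(2)] lie_inner_coords[OF vf(3) vf(3)]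
    lie_inner_coords[OF vf(1) vf(2)] lie_inner_coords[OF vf(1) vf(3)] lie_inner_coords[OF vf(2) vf(3)]
    lie_inner_coords[OF Y vf(1)] lie_inner_coords[OF Y vf(2)] lie_inner_coords[OF Y vf(3)]
  let ?t = "coords m X T" and ?n = "coords m X N" and ?b = "coords m X B"
  have on: "?t \<bullet> ?t = 1" "?n \<bullet> ?n = 1" "?b \<bullet> ?b = 1" "?t \<bullet> ?n = 0" "?t \<bullet> ?b = 0" "?n \<bullet> ?b = 0"
    "det (vector [?t, ?n, ?b] :: real^3^3) > 0"
    using f c by (simp_all add: positive_frame_def)
  have "coords m X Y - (\<nu> *\<^sub>R ?n + \<beta> *\<^sub>R ?b) = 0"
    by (rule orthogonal_to_frame_eq_0[OF on(3) positive_orthonormal_cross(1)[OF on]])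
       (use on c assms in \<open>simp_all add: inner_diff_left inner_diff_right inner_add_left inner_add_right inner_commute\<close>)
  then show ?thesis by simp
qed

text \<open>By antisymmetry of the connection form, \<open>\<nabla>\<^sub>T T = 0\<close>, \<open>\<nabla>\<^sub>T N = \<tau>\<^sub>G B\<close> and \<open>\<nabla>\<^sub>T B = - \<tau>\<^sub>G N\<close>. These
  terms are subtracted from the covariant Frenet equations, which shifts the torsion by \<open>\<tau>\<^sub>G\<close>.\<close>

lemma frenet_apparatus_equations:
  assumes F: "frenet_apparatus m nabla X I \<gamma> T N B \<kappa> \<tau>"
  shows "frenet_equations I (\<lambda>s. coords m X (T s)) (\<lambda>s. coords m X (N s)) (\<lambda>s. coords m X (B s))
           \<kappa> (\<lambda>s. \<tau> s - lie_torsion m T N B s)"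
  unfolding frenet_equations_def
proof
  fix s assume s: "s \<in> I"
  let ?t = "coords m X (T s)" and ?n = "coords m X (N s)" and ?b = "coords m X (B s)"
  have lie: "T s \<in> lie_algebra" "N s \<in> lie_algebra" "B s \<in> lie_algebra"
    using F s unfolding frenet_apparatus_def smooth_lie_map_def by blast+
  note vf = lie[THEN lie_algebra_vector_field]
  have fr: "positive_frame m X (T s) (N s) (B s)" using F s unfolding frenet_apparatus_def by blast
  define c where "c = lie_torsion m T N B s"
  have c: "c = connection_form (T s) (N s) (B s)" using lie_torsion_connection_form[of T s N B] lie by (simp add: c_def)
  have nT: "coords m X (nabla (T s) (T s)) = 0 *\<^sub>R ?n + 0 *\<^sub>R ?b"
    by (rule frame_coords[OF fr lie nabla_vector_field[OF vf(1,1)]])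
       (use connection_form_repeated lie in \<open>simp_all add: connection_form_def\<close>)
  have nN: "coords m X (nabla (T s) (N s)) = 0 *\<^sub>R ?n + c *\<^sub>R ?b"
    by (rule frame_coords[OF fr lie nabla_vector_field[OF vf(1,2)]])
       (use connection_form_repeated lie in \<open>simp_all add: connection_form_def c\<close>)
  have nB: "coords m X (nabla (T s) (B s)) = (- c) *\<^sub>R ?n + 0 *\<^sub>R ?b"
    by (rule frame_coords[OF fr lie nabla_vector_field[OF vf(1,3)]])
       (use connection_form_repeated connection_form_skew(1)[OF lie] lie in \<open>simp_all add: connection_form_def c\<close>)
  have cov: "((\<lambda>s. coords m X (U s)) has_vector_derivative
      coords m X (cov_deriv m nabla X I T U s) - coords m X (nabla (T s) (U s))) (at s within I)"
    if "smooth_lie_map m X I U" for U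
  proof -
    have U: "vector_field (U s)" and sm: "smooth_on I (\<lambda>t. coords m X (U t))"
      using that s lie_algebra_vector_field by (auto simp: smooth_lie_map_def)
    have "((\<lambda>s. coords m X (U s)) has_vector_derivative vector_derivative (\<lambda>s. coords m X (U s)) (at s within I)) (at s within I)"
      using smooth_on_differentiable_within[OF sm s] by (simp add: vector_derivative_works)
    moreover have "coords m X (cov_deriv m nabla X I T U s)
        = vector_derivative (\<lambda>s. coords m X (U s)) (at s within I) + coords m X (nabla (T s) (U s))"
      by (simp add: cov_deriv_def lie_deriv_map_def coords_add linear_comb_vector_field
          nabla_vector_field vf U coords_linear_comb)
    ultimately show ?thesis by simp
  qed
  have sm: "smooth_lie_map m X I T" "smooth_lie_map m X I N" "smooth_lie_map m X I B"
    using F unfolding frenet_apparatus_def by blast+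
  have dT: "coords m X (cov_deriv m nabla X I T T s) = \<kappa> s *\<^sub>R ?n"
    and dN: "coords m X (cov_deriv m nabla X I T N s) = - \<kappa> s *\<^sub>R ?t + \<tau> s *\<^sub>R ?b"
    and dB: "coords m X (cov_deriv m nabla X I T B s) = - \<tau> s *\<^sub>R ?n"
  proof -
    have "cov_deriv m nabla X I T T s = vf_scale (\<kappa> s) (N s)"
      and "cov_deriv m nabla X I T N s = vf_add (vf_scale (- \<kappa> s) (T s)) (vf_scale (\<tau> s) (B s))"
      and "cov_deriv m nabla X I T B s = vf_scale (- \<tau> s) (N s)"
      using F s unfolding frenet_apparatus_def by blast+
    then show "coords m X (cov_deriv m nabla X I T T s) = \<kappa> s *\<^sub>R ?n"
      and "coords m X (cov_deriv m nabla X I T N s) = - \<kappa> s *\<^sub>R ?t + \<tau> s *\<^sub>R ?b"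
      and "coords m X (cov_deriv m nabla X I T B s) = - \<tau> s *\<^sub>R ?n"
      by (simp_all only: coords_add coords_scale vector_field_scale vf)
  qed
  have "0 < \<kappa> s" using F s unfolding frenet_apparatus_def by blast
  moreover have "?t \<bullet> ?t = 1 \<and> ?n \<bullet> ?n = 1 \<and> ?b \<bullet> ?b = 1 \<and> ?t \<bullet> ?n = 0 \<and> ?t \<bullet> ?b = 0 \<and> ?n \<bullet> ?b = 0 \<and>
      det (vector [?t, ?n, ?b] :: real^3^3) > 0"
    using fr vf by (simp add: positive_frame_def lie_inner_coords)
  moreover have "((\<lambda>s. coords m X (T s)) has_vector_derivative \<kappa> s *\<^sub>R ?n) (at s within I)"
    using cov[OF sm(1)] by (simp add: dT nT)
  moreover have "((\<lambda>s. coords m X (N s)) has_vector_derivative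
      - \<kappa> s *\<^sub>R ?t + (\<tau> s - c) *\<^sub>R ?b) (at s within I)"
    using cov[OF sm(2)] by (simp add: dN nN scaleR_left_diff_distrib algebra_simps)
  moreover have "((\<lambda>s. coords m X (B s)) has_vector_derivative - (\<tau> s - c) *\<^sub>R ?n) (at s within I)"
    using cov[OF sm(3)] by (simp add: dB nB scaleR_left_diff_distrib algebra_simps)
  ultimately show "0 < \<kappa> s \<and> ?t \<bullet> ?t = 1 \<and> ?n \<bullet> ?n = 1 \<and> ?b \<bullet> ?b = 1 \<and> ?t \<bullet> ?n = 0 \<and> ?t \<bullet> ?b = 0 \<and> ?n \<bullet> ?b = 0 \<and>
      det (vector [?t, ?n, ?b] :: real^3^3) > 0 \<and>
      ((\<lambda>s. coords m X (T s)) has_vector_derivative \<kappa> s *\<^sub>R ?n) (at s within I) \<and>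
      ((\<lambda>s. coords m X (N s)) has_vector_derivative
        - \<kappa> s *\<^sub>R ?t + (\<tau> s - lie_torsion m T N B s) *\<^sub>R ?b) (at s within I) \<and>
      ((\<lambda>s. coords m X (B s)) has_vector_derivative - (\<tau> s - lie_torsion m T N B s) *\<^sub>R ?n) (at s within I)"
    unfolding c_def by blast
qed

end

theorem corollary3p3:
  fixes m :: "'g::lie_group_3 metric" and nabla :: "'g connection"
    and X :: "3 \<Rightarrow> 'g vfield" and I :: "real set" and \<gamma> \<beta> :: "real \<Rightarrow> 'g"
    and T N B T' N' B' :: "real \<Rightarrow> 'g vfield" and \<kappa> \<tau> \<kappa>' \<tau>' :: "real \<Rightarrow> real"
  assumes "riemannian_metric m" and "bi_invariant m" and "levi_civita m nabla"
    and "orthonormal_basis m X"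
    and "is_interval I" and "interior I \<noteq> {}"
    and "frenet_curve m nabla X I \<gamma> T N B \<kappa> \<tau>"
    and "natural_mate m nabla X I N \<beta> T' N' B' \<kappa>' \<tau>'"
  shows "rectifying_curve m nabla X I \<gamma> \<longleftrightarrow>
    (\<exists>a. a \<noteq> 0 \<and>
       (\<forall>s\<in>I. a * (\<kappa> s)\<^sup>2 = (\<tau>' s - lie_torsion m T' N' B' s) * (\<kappa>' s)\<^sup>2))"
proof -
  interpret bi_invariant_lie_group m nabla X by standard fact+
  let ?H = "harmonic_curvature m T N B \<kappa> \<tau>"
  let ?h = "\<lambda>s. (\<tau>' s - lie_torsion m T' N' B' s) * (\<kappa>' s)\<^sup>2 / (\<kappa> s)\<^sup>2"
  note I = interval_not_isolated[OF assms(5,6)]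
  have F: "frenet_apparatus m nabla X I \<gamma> T N B \<kappa> \<tau>"
    and F': "frenet_apparatus m nabla X I \<beta> T' N' B' \<kappa>' \<tau>'" and mate: "\<And>s. s \<in> I \<Longrightarrow> T' s = N s"
    using assms(7,8) by (auto simp: frenet_curve_def natural_mate_def)
  have dH: "(?H has_real_derivative ?h s) (at s within I)" if "s \<in> I" for s
    unfolding harmonic_curvature_def
    by (rule natural_mate_ratio_derivative[OF I frenet_apparatus_equations[OF F]
          frenet_apparatus_equations[OF F'] arg_cong[OF mate, of _ "coords m X"] that])
  \<comment> \<open>Whichever apparatus witnesses that \<open>\<gamma>\<close> is rectifying, its harmonic curvature is \<open>H\<close>.\<close>
  have "rectifying_curve m nabla X I \<gamma> \<longleftrightarrow> (\<exists>a b. a \<noteq> 0 \<and> (\<forall>s\<in>I. ?H s = a * s + b))"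
  proof
    assume "rectifying_curve m nabla X I \<gamma>"
    then obtain T2 N2 B2 \<kappa>2 \<tau>2 a b where F2: "frenet_apparatus m nabla X I \<gamma> T2 N2 B2 \<kappa>2 \<tau>2"
      and ab: "a \<noteq> 0" "\<And>s. s \<in> I \<Longrightarrow> harmonic_curvature m T2 N2 B2 \<kappa>2 \<tau>2 s = a * s + b"
      unfolding rectifying_curve_def by blast
    have "T2 s = T s" if "s \<in> I" for s
    proof (rule left_invariant_eqI)
      show "T2 s \<in> lie_algebra" "T s \<in> lie_algebra"
        using F F2 that unfolding frenet_apparatus_def smooth_lie_map_def by blast+
      have "T2 s (\<gamma> s) = velocity I \<gamma> s" "T s (\<gamma> s) = velocity I \<gamma> s"
        using F F2 that unfolding frenet_apparatus_def by blast+
      then show "T2 s (\<gamma> s) = T s (\<gamma> s)" by simp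
    qed
    then have "harmonic_curvature m T2 N2 B2 \<kappa>2 \<tau>2 s = ?H s" if "s \<in> I" for s
      using frenet_unique[OF I frenet_apparatus_equations[OF F2] frenet_apparatus_equations[OF F] _ that]
      by (simp add: harmonic_curvature_def)
    then have "\<forall>s\<in>I. ?H s = a * s + b" using ab(2) by metis
    then show "\<exists>a b. a \<noteq> 0 \<and> (\<forall>s\<in>I. ?H s = a * s + b)" using ab(1) by blast
  next
    assume "\<exists>a b. a \<noteq> 0 \<and> (\<forall>s\<in>I. ?H s = a * s + b)"
    then show "rectifying_curve m nabla X I \<gamma>" using F unfolding rectifying_curve_def by blast
  qed
  also have "\<dots> \<longleftrightarrow> (\<exists>a. a \<noteq> 0 \<and> (\<forall>s\<in>I. ?h s = a))"
    using affine_iff_constant_derivative[OF assms(5,6) dH] by auto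
  also have "\<dots> \<longleftrightarrow> (\<exists>a. a \<noteq> 0 \<and>
       (\<forall>s\<in>I. a * (\<kappa> s)\<^sup>2 = (\<tau>' s - lie_torsion m T' N' B' s) * (\<kappa>' s)\<^sup>2))"
  proof -
    have "\<kappa> s \<noteq> 0" if "s \<in> I" for s
      using F that unfolding frenet_apparatus_def by (metis less_irrefl)
    then have "?h s = a \<longleftrightarrow> a * (\<kappa> s)\<^sup>2 = (\<tau>' s - lie_torsion m T' N' B' s) * (\<kappa>' s)\<^sup>2"
      if "s \<in> I" for s a using that by (auto simp: nonzero_divide_eq_eq)
    then show ?thesis by auto
  qed
  finally show ?thesis .
qed

end
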